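(* Assume that the cost functions $c_t(\boldsymbol{x}_t,\boldsymbol{u}_t,\boldsymbol{\gamma}_t)$, $t\in[\mathcal{T}]$, are absolutely continuous, and that for each feasible integer controller $\pi^\gamma\in\mathfrak{N}^\gamma$ the set of feasible continuous controllers $$\mathfrak{A}(\pi^\gamma)=\{\pi^u\in\mathfrak{N}^u \mid (\pi^u,\pi^\gamma)\text{ is feasible for (DRMIC)}\}$$ has non-empty interior in $\mathfrak{N}^u$ (with respect to the distance $d$). Then $$\lim_{\delta\searrow 0}\ \inf_{\boldsymbol{w}:\,\epsilon(\boldsymbol{w})\ge\delta} J^\ast\big(\Pi^u(\boldsymbol{w}),\Pi^\gamma(\boldsymbol{w})\big)=J^\ast\big(\mathfrak{N}^u,\mathfrak{N}^\gamma\big).$$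
   Context: **Notation.** $[N]=\{1,\dots,N\}$. $\mathcal{T}$ is a finite horizon. The disturbance is $\boldsymbol\xi=(\boldsymbol\xi_1,\dots,\boldsymbol\xi_{\mathcal T})$ with $\boldsymbol\xi_t=(\xi_{t,1},\dots,\xi_{t,n_\xi})\in\mathbb{R}^{n_\xi}$, and $\boldsymbol\xi_{[t]}=(\boldsymbol\xi_1,\dots,\boldsymbol\xi_t)$. Its support is the hyperrectangle $\varXi=\prod_{t\in[\mathcal T],i\in[n_\xi]}\varXi_{t,i}$, $\varXi_{t,i}=[l_{t,i},v_{t,i}]$ with $l_{t,i}<v_{t,i}$ real; $\varXi_{[t]}$ is the support of $\boldsymbol\xi_{[t]}$. **System and problem (DRMIC).** States $\boldsymbol x_t\in\mathbb{R}^{n_x}$, continuous controls $\boldsymbol u_t\in\mathbb{R}^{n_u}$ and integer controls $\boldsymbol\gamma_t\in\mathbb{Z}^{n_\gamma}$ satisfy $\boldsymbol x_{t+1}=\boldsymbol A_t\boldsymbol x_t+\boldsymbol B_t\boldsymbol u_t+\boldsymbol C_t\boldsymbol\gamma_t+\boldsymbol D_t\boldsymbol\xi_t$ for $t=0,\dots,\mathcal T-1$, with given matrices, given $\boldsymbol x_0=\boldsymbol x$, and the convention $\boldsymbol u_0=0,\boldsymbol\gamma_0=0,\boldsymbol\xi_0=0$. A causal policy is $\boldsymbol\pi=(\pi^u,\pi^\gamma)$, $\pi^u=(\boldsymbol u_1^\pi(\cdot),\dots,\boldsymbol u_{\mathcal T}^\pi(\cdot))$, $\pi^\gamma=(\boldsymbol\gamma_1^\pi(\cdot),\dots,\boldsymbol\gamma_{\mathcal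 T}^\pi(\cdot))$, with $\boldsymbol u_t^\pi:\varXi_{[t]}\to\mathbb{R}^{n_u}$, $\boldsymbol\gamma_t^\pi:\varXi_{[t]}\to\mathbb{Z}^{n_\gamma}$. It is feasible for (DRMIC) if, with the induced states, $\sum_{t=1}^{\mathcal T}\tilde{\boldsymbol A}_t\boldsymbol x_t+\tilde{\boldsymbol B}_t\boldsymbol u_t^\pi+\tilde{\boldsymbol C}_t\boldsymbol\gamma_t^\pi+\tilde{\boldsymbol D}_t\boldsymbol\xi_t\le\boldsymbol q$ for all $\boldsymbol\xi\in\varXi$ (componentwise; given matrices and vector $\boldsymbol q$). The cost is $J(\boldsymbol x,\boldsymbol\pi)=\sup_{\mathbb P\in\mathscr B}\mathbb E_{\boldsymbol\xi\sim\mathbb P}\big[\sum_{t=1}^{\mathcal T}\alpha^t c_t(\boldsymbol x_t,\boldsymbol u_t^\pi,\boldsymbol\gamma_t^\pi)\big]$, where $\mathscr B$ is a given nonempty set of Borel probability measures on $\varXi$ (the ambiguity set), $\alpha^t\in[0,1]$, and $c_t$ are real-valued. For sets $\Pi^u,\Pi^\gamma$ of continuous and integer policies, $J^\ast(\Pi^u,\Pi^\gamma)$ is the infimum of $J(\boldsymbol x,\boldsymbol\pi)$ over feasible $\boldsymbol\pi\in\Pi^u\times\Pi^\gamma$ ($+\infty$ if there is none). An integer controller $\pi^\gamma\in\mathfrak N^\gamma$ is feasible if $(\pi^u,\pi^\gamma)$ is feasible for some $\pi^u\in\mathfrak N^u$. "Absolutely continuous" cost functions are in particular continuous in $(\boldsymbol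 x,\boldsymbol u)$ for each fixed $\boldsymbol\gamma$. **Breakpoints and lifted policies.** A breakpoint choice $\boldsymbol w$ consists of integers $p_{t,i}\ge1$ and reals $l_{t,i}=w_{t,i,0}\le w_{t,i,1}\le\dots\le w_{t,i,p_{t,i}-1}\le w_{t,i,p_{t,i}}=v_{t,i}$ for all $t,i$. For $\xi_{t,i}\in\varXi_{t,i}$: $V_{t,i,1}=\min\{\xi_{t,i},w_{t,i,1}\}$, $V_{t,i,j}=\max\{\min\{\xi_{t,i},w_{t,i,j}\}-w_{t,i,j-1},0\}$ for $2\le j\le p_{t,i}$; $Q_{t,i,j}=0$ if $\xi_{t,i}<w_{t,i,j}$ and $1$ if $\xi_{t,i}\ge w_{t,i,j}$, for $j\in[p_{t,i}-1]$. Let $\boldsymbol V_{[t]}(\boldsymbol\xi_{[t]})$ (resp. $\boldsymbol Q_{[t]}(\boldsymbol\xi_{[t]})$) be the vector stacking all $V_{t',i,j}$ (resp. $Q_{t',i,j}$) with $t'\le t$, $i\in[n_\xi]$, of dimension $n_{V_t}=\sum_{t'\le t}\sum_i p_{t',i}$ (resp. $n_{Q_t}=\sum_{t'\le t}\sum_i(p_{t',i}-1)$). Then $\Pi^u(\boldsymbol w)$ is the set of $\pi^u$ with $\boldsymbol u_t^\pi(\boldsymbol\xi_{[t]})=\boldsymbol Y_t\boldsymbol V_{[t]}(\boldsymbol\xi_{[t]})+\boldsymbol y_t^0$, $\boldsymbol Y_t\in\mathbb R^{n_u\times n_{V_t}}$, $\boldsymbol y_t^0\in\mathbb R^{n_u}$;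 $\Pi^\gamma(\boldsymbol w)$ is the set of $\pi^\gamma$ with $\boldsymbol\gamma_t^\pi(\boldsymbol\xi_{[t]})=\boldsymbol Z_t\boldsymbol Q_{[t]}(\boldsymbol\xi_{[t]})+\boldsymbol z_t^0$, $\boldsymbol Z_t\in\mathbb Z^{n_\gamma\times n_{Q_t}}$, $\boldsymbol z_t^0\in\mathbb Z^{n_\gamma}$. The largest segment is $\epsilon(\boldsymbol w)=\max_{t\in[\mathcal T],i\in[n_\xi],j\in[p_{t,i}]}(w_{t,i,j}-w_{t,i,j-1})$. **Additive policies.** $\mathfrak N^u$ is the set of $\pi^u$ such that for all $t\in[\mathcal T]$, $j\in[n_u]$, $u^\pi_{t,j}(\boldsymbol\xi_{[t]})=\sum_{t'=1}^t\sum_{i=1}^{n_\xi}f_{t,j,t',i}(\xi_{t',i})$ with each $f_{t,j,t',i}$ continuous on $\varXi_{t',i}$. $\mathfrak N^\gamma$ is the set of $\pi^\gamma$ such that for all $t\in[\mathcal T]$, $j\in[n_\gamma]$, $\gamma^\pi_{t,j}(\boldsymbol\xi_{[t]})=\sum_{t'=1}^t\sum_{i=1}^{n_\xi}f_{t,j,t',i}(\xi_{t',i})$ with $f_{t,j,t',i}\in\mathrm{PInt}(\varXi_{t',i})$, where $\mathrm{PInt}([l,v])$ is the set of functions $f:[l,v]\to\mathbb Z$ for which there are $l=w_0\le w_1\le\dots\le w_n=v$ such that $f$ is constant on $[w_{i-1},w_i)$ for every $i\in[n]$. The distance on continuous policies is $d(\pi_1^u,\pi_2^u)=\sum_{t=1}^{\mathcal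 T}\sum_{j=1}^{n_u}\|u^{\pi_1}_{t,j}-u^{\pi_2}_{t,j}\|_\infty$ (supremum norm on $\varXi_{[t]}$). *)

theory Defs
  imports "HOL-Probability.Probability"
begin

text \<open>
  The type parameters index the coordinates of the state, the continuous control, the integer
  control, the disturbance and the joint constraint, in this order. Time indices outside the range
  used by the problem (\<open>0..T-1\<close> for the dynamics, \<open>1..T\<close> for everything else) are never evaluated.
\<close>

record ('x::finite, 'u::finite, 'g::finite, 'k::finite, 'm::finite) drmic =
  horizon :: nat
  lower :: "nat \<Rightarrow> real^'k"
  upper :: "nat \<Rightarrow> real^'k"
  init :: "real^'x"
  dynA :: "nat \<Rightarrow> real^'x^'x"
  dynB :: "nat \<Rightarrow> real^'u^'x"
  dynC :: "nat \<Rightarrow> real^'g^'x"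
  dynD :: "nat \<Rightarrow> real^'k^'x"
  conA :: "nat \<Rightarrow> real^'x^'m"
  conB :: "nat \<Rightarrow> real^'u^'m"
  conC :: "nat \<Rightarrow> real^'g^'m"
  conD :: "nat \<Rightarrow> real^'k^'m"
  rhs :: "real^'m"
  discount :: "nat \<Rightarrow> real"
  cost :: "nat \<Rightarrow> real^'x \<Rightarrow> real^'u \<Rightarrow> int^'g \<Rightarrow> real"
  ambiguity :: "(nat \<Rightarrow> real^'k) measure set"

text \<open>
  A disturbance history up to time \<open>t\<close> is an extensional function on \<open>{1..t}\<close>; the history of \<open>\<xi>\<close>
  up to \<open>t\<close> is \<open>restrict \<xi> {1..t}\<close>. Policies are extensional in time and in the history, so that
  equality of policies is equality on \<open>\<Xi>\<^bsub>[t]\<^esub>\<close> for all \<open>t \<in> {1..T}\<close>, and causality is built in.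
\<close>

type_synonym 'k hist = "nat \<Rightarrow> real^'k"
type_synonym ('k, 'u) upolicy = "nat \<Rightarrow> 'k hist \<Rightarrow> real^'u"
type_synonym ('k, 'g) gpolicy = "nat \<Rightarrow> 'k hist \<Rightarrow> int^'g"

definition Xi_upto ::
  "('x::finite, 'u::finite, 'g::finite, 'k::finite, 'm::finite) drmic \<Rightarrow> nat \<Rightarrow> 'k hist set" where
  "Xi_upto M t = (\<Pi>\<^sub>E s\<in>{1..t}. cbox (lower M s) (upper M s))"

abbreviation Xi ::
  "('x::finite, 'u::finite, 'g::finite, 'k::finite, 'm::finite) drmic \<Rightarrow> 'k hist set" where
  "Xi M \<equiv> Xi_upto M (horizon M)"

definition policies ::
  "('x::finite, 'u::finite, 'g::finite, 'k::finite, 'm::finite) drmic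
    \<Rightarrow> (nat \<Rightarrow> 'k hist \<Rightarrow> 'c) set" where
  "policies M = (\<Pi>\<^sub>E t\<in>{1..horizon M}. Xi_upto M t \<rightarrow>\<^sub>E UNIV)"

definition real_vec :: "int^'n \<Rightarrow> real^'n" where
  "real_vec z = (\<chi> i. real_of_int (z $ i))"

text \<open>The first transition is \<open>x\<^sub>1 = A\<^sub>0 x\<^sub>0\<close> because controls and disturbance vanish at time 0.\<close>

fun state ::
  "('x::finite, 'u::finite, 'g::finite, 'k::finite, 'm::finite) drmic
    \<Rightarrow> ('k, 'u) upolicy \<Rightarrow> ('k, 'g) gpolicy \<Rightarrow> 'k hist \<Rightarrow> nat \<Rightarrow> real^'x" where
  "state M u g \<xi> 0 = init M"
| "state M u g \<xi> (Suc t) =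
     dynA M t *v state M u g \<xi> t +
     (if t = 0 then 0
      else dynB M t *v u t (restrict \<xi> {1..t}) +
           dynC M t *v real_vec (g t (restrict \<xi> {1..t})) +
           dynD M t *v \<xi> t)"

definition feasible ::
  "('x::finite, 'u::finite, 'g::finite, 'k::finite, 'm::finite) drmic
    \<Rightarrow> ('k, 'u) upolicy \<Rightarrow> ('k, 'g) gpolicy \<Rightarrow> bool" where
  "feasible M u g \<longleftrightarrow>
     (\<forall>\<xi>\<in>Xi M. \<forall>r.
        (\<Sum>t = 1..horizon M.
           conA M t *v state M u g \<xi> t +
           conB M t *v u t (restrict \<xi> {1..t}) +
           conC M t *v real_vec (g t (restrict \<xi> {1..t})) +
           conD M t *v \<xi> t) $ r \<le> rhs M $ r)"

text \<open>Borel probability measures on the support \<open>\<Xi>\<close>, i.e. with underlying space \<open>\<Xi>\<close>.\<close>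

definition prob_measures ::
  "('x::finite, 'u::finite, 'g::finite, 'k::finite, 'm::finite) drmic
    \<Rightarrow> 'k hist measure set" where
  "prob_measures M =
     {P. prob_space P \<and>
         sets P = sets (restrict_space (Pi\<^sub>M {1..horizon M} (\<lambda>_. borel)) (Xi M))}"

definition J ::
  "('x::finite, 'u::finite, 'g::finite, 'k::finite, 'm::finite) drmic
    \<Rightarrow> ('k, 'u) upolicy \<Rightarrow> ('k, 'g) gpolicy \<Rightarrow> ereal" where
  "J M u g =
     (SUP P\<in>ambiguity M.
        ereal (\<integral>\<xi>. (\<Sum>t = 1..horizon M.
          discount M t *
          cost M t (state M u g \<xi> t) (u t (restrict \<xi> {1..t})) (g t (restrict \<xi> {1..t}))) \<partial>P))"

definition J_opt ::
  "('x::finite, 'u::finite, 'g::finite, 'k::finite, 'm::finite) drmic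
    \<Rightarrow> ('k, 'u) upolicy set \<Rightarrow> ('k, 'g) gpolicy set \<Rightarrow> ereal" where
  "J_opt M U G = (INF (u, g)\<in>{(u, g). u \<in> U \<and> g \<in> G \<and> feasible M u g}. J M u g)"

text \<open>
  A breakpoint choice is a pair \<open>(p, w)\<close>. Consecutive breakpoints may coincide; in particular
  \<open>w t i (p t i - 1) = upper M t $ i\<close> is allowed, which lets \<open>liftQ\<close> jump at the right end point.
\<close>

type_synonym 'k breakpoints = "(nat \<Rightarrow> 'k \<Rightarrow> nat) \<times> (nat \<Rightarrow> 'k \<Rightarrow> nat \<Rightarrow> real)"

definition breakpoint_choices ::
  "('x::finite, 'u::finite, 'g::finite, 'k::finite, 'm::finite) drmic
    \<Rightarrow> 'k breakpoints set" where
  "breakpoint_choices M =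
     {(p, w). \<forall>t\<in>{1..horizon M}. \<forall>i.
        p t i \<ge> 1 \<and> w t i 0 = lower M t $ i \<and> w t i (p t i) = upper M t $ i \<and>
        (\<forall>j\<in>{1..p t i}. w t i (j - 1) \<le> w t i j)}"

definition liftV :: "'k breakpoints \<Rightarrow> nat \<Rightarrow> 'k \<Rightarrow> nat \<Rightarrow> real \<Rightarrow> real" where
  "liftV = (\<lambda>(p, w) t i j x.
     if j = 1 then min x (w t i 1) else max (min x (w t i j) - w t i (j - 1)) 0)"

definition liftQ :: "'k breakpoints \<Rightarrow> nat \<Rightarrow> 'k \<Rightarrow> nat \<Rightarrow> real \<Rightarrow> int" where
  "liftQ = (\<lambda>(p, w) t i j x. if x < w t i j then 0 else 1)"

text \<open>
  Index sets of the stacked vectors \<open>V\<^bsub>[t]\<^esub>\<close> and \<open>Q\<^bsub>[t]\<^esub>\<close>. Their dimensions depend on the breakpoint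
  choice, so the coefficient matrices are functions on (row index, stacked index).
\<close>

definition idxV :: "'k breakpoints \<Rightarrow> nat \<Rightarrow> (nat \<times> 'k \<times> nat) set" where
  "idxV = (\<lambda>(p, w) t. {(s, i, j). s \<in> {1..t} \<and> j \<in> {1..p s i}})"

definition idxQ :: "'k breakpoints \<Rightarrow> nat \<Rightarrow> (nat \<times> 'k \<times> nat) set" where
  "idxQ = (\<lambda>(p, w) t. {(s, i, j). s \<in> {1..t} \<and> j \<in> {1..p s i - 1}})"

definition Pi_u ::
  "('x::finite, 'u::finite, 'g::finite, 'k::finite, 'm::finite) drmic
    \<Rightarrow> 'k breakpoints \<Rightarrow> ('k, 'u) upolicy set" where
  "Pi_u M b =
     {u \<in> policies M. \<forall>t\<in>{1..horizon M}.
        \<exists>(Y :: 'u \<Rightarrow> nat \<times> 'k \<times> nat \<Rightarrow> real) (y0 :: real^'u). \<forall>\<xi>\<in>Xi_upto M t. \<forall>a.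
          u t \<xi> $ a = (\<Sum>(s, i, j)\<in>idxV b t. Y a (s, i, j) * liftV b s i j (\<xi> s $ i)) + y0 $ a}"

definition Pi_g ::
  "('x::finite, 'u::finite, 'g::finite, 'k::finite, 'm::finite) drmic
    \<Rightarrow> 'k breakpoints \<Rightarrow> ('k, 'g) gpolicy set" where
  "Pi_g M b =
     {g \<in> policies M. \<forall>t\<in>{1..horizon M}.
        \<exists>(Z :: 'g \<Rightarrow> nat \<times> 'k \<times> nat \<Rightarrow> int) (z0 :: int^'g). \<forall>\<xi>\<in>Xi_upto M t. \<forall>a.
          g t \<xi> $ a = (\<Sum>(s, i, j)\<in>idxQ b t. Z a (s, i, j) * liftQ b s i j (\<xi> s $ i)) + z0 $ a}"

definition largest_segment ::
  "('x::finite, 'u::finite, 'g::finite, 'k::finite, 'm::finite) drmic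
    \<Rightarrow> 'k breakpoints \<Rightarrow> real" where
  "largest_segment M = (\<lambda>(p, w).
     Max {w t i j - w t i (j - 1) | t i j. t \<in> {1..horizon M} \<and> j \<in> {1..p t i}})"

definition N_u ::
  "('x::finite, 'u::finite, 'g::finite, 'k::finite, 'm::finite) drmic
    \<Rightarrow> ('k, 'u) upolicy set" where
  "N_u M =
     {u \<in> policies M. \<forall>t\<in>{1..horizon M}. \<forall>a. \<exists>f :: nat \<Rightarrow> 'k \<Rightarrow> real \<Rightarrow> real.
        (\<forall>s\<in>{1..t}. \<forall>i. continuous_on {lower M s $ i..upper M s $ i} (f s i)) \<and>
        (\<forall>\<xi>\<in>Xi_upto M t. u t \<xi> $ a = (\<Sum>s = 1..t. \<Sum>i\<in>UNIV. f s i (\<xi> s $ i)))}"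

text \<open>
  The value at the right end point \<open>v\<close> is unconstrained because the pieces are half-open.
\<close>

definition PInt :: "real \<Rightarrow> real \<Rightarrow> (real \<Rightarrow> int) set" where
  "PInt l v =
     {f. \<exists>(n::nat) (w :: nat \<Rightarrow> real). w 0 = l \<and> w n = v \<and>
         (\<forall>i\<in>{1..n}. w (i - 1) \<le> w i \<and> f constant_on {w (i - 1)..<w i})}"

definition N_g ::
  "('x::finite, 'u::finite, 'g::finite, 'k::finite, 'm::finite) drmic
    \<Rightarrow> ('k, 'g) gpolicy set" where
  "N_g M =
     {g \<in> policies M. \<forall>t\<in>{1..horizon M}. \<forall>a. \<exists>f :: nat \<Rightarrow> 'k \<Rightarrow> real \<Rightarrow> int.
        (\<forall>s\<in>{1..t}. \<forall>i. f s i \<in> PInt (lower M s $ i) (upper M s $ i)) \<and>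
        (\<forall>\<xi>\<in>Xi_upto M t. g t \<xi> $ a = (\<Sum>s = 1..t. \<Sum>i\<in>UNIV. f s i (\<xi> s $ i)))}"

text \<open>
  The distance lives on \<open>N_u M\<close>. It is set to 0 elsewhere only because the locale \<open>Metric_space\<close>
  demands nonnegativity also off the carrier, where the supremum of an unbounded set would occur.
\<close>

definition policy_dist ::
  "('x::finite, 'u::finite, 'g::finite, 'k::finite, 'm::finite) drmic
    \<Rightarrow> ('k, 'u) upolicy \<Rightarrow> ('k, 'u) upolicy \<Rightarrow> real" where
  "policy_dist M u1 u2 =
     (if u1 \<in> N_u M \<and> u2 \<in> N_u M
      then \<Sum>t = 1..horizon M. \<Sum>a\<in>UNIV. SUP \<xi>\<in>Xi_upto M t. \<bar>u1 t \<xi> $ a - u2 t \<xi> $ a\<bar>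
      else 0)"

definition feasible_u ::
  "('x::finite, 'u::finite, 'g::finite, 'k::finite, 'm::finite) drmic
    \<Rightarrow> ('k, 'g) gpolicy \<Rightarrow> ('k, 'u) upolicy set" where
  "feasible_u M g = {u \<in> N_u M. feasible M u g}"

lemma N_u_bdd:
  fixes M :: "('x::finite, 'u::finite, 'g::finite, 'k::finite, 'm::finite) drmic"
  assumes "u1 \<in> N_u M" "u2 \<in> N_u M" "t \<in> {1..horizon M}"
  shows "bdd_above ((\<lambda>\<xi>. \<bar>u1 t \<xi> $ a - u2 t \<xi> $ a\<bar>) ` Xi_upto M t)"
proof -
  have bdd: "\<exists>B. \<forall>\<xi>\<in>Xi_upto M t. \<bar>u t \<xi> $ a\<bar> \<le> B" if u: "u \<in> N_u M" for u
  proof -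
    obtain f where f: "\<And>s i. s \<in> {1..t} \<Longrightarrow> continuous_on {lower M s $ i..upper M s $ i} (f s i)"
      and eq: "\<And>\<xi>. \<xi> \<in> Xi_upto M t \<Longrightarrow> u t \<xi> $ a = (\<Sum>s = 1..t. \<Sum>i\<in>UNIV. f s i (\<xi> s $ i))"
      using u assms(3) unfolding N_u_def by blast
    have "\<exists>c. \<forall>x\<in>{lower M s $ i..upper M s $ i}. \<bar>f s i x\<bar> \<le> c" if "s \<in> {1..t}" for s i
    proof -
      have "bounded (f s i ` {lower M s $ i..upper M s $ i})"
        using compact_continuous_image[OF f[OF that]] compact_imp_bounded by blast
      then show ?thesis by (auto simp: bounded_iff)
    qed
    then obtain c where c: "\<And>s i x. s \<in> {1..t} \<Longrightarrow> x \<in> {lower M s $ i..upper M s $ i} \<Longrightarrow>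
        \<bar>f s i x\<bar> \<le> c s i"
      by metis
    have "\<bar>u t \<xi> $ a\<bar> \<le> (\<Sum>s = 1..t. \<Sum>i\<in>UNIV. c s i)" if \<xi>: "\<xi> \<in> Xi_upto M t" for \<xi>
    proof -
      have "\<bar>f s i (\<xi> s $ i)\<bar> \<le> c s i" if "s \<in> {1..t}" for s i
      proof -
        have "\<xi> s \<in> cbox (lower M s) (upper M s)" using \<xi> that by (auto simp: Xi_upto_def PiE_iff)
        then show ?thesis using c[OF that, of "\<xi> s $ i" i] by (auto simp: mem_box_cart)
      qed
      then have "(\<Sum>s = 1..t. \<bar>\<Sum>i\<in>UNIV. f s i (\<xi> s $ i)\<bar>) \<le> (\<Sum>s = 1..t. \<Sum>i\<in>UNIV. c s i)"
        by (intro sum_mono order_trans[OF sum_abs]) auto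
      then show ?thesis unfolding eq[OF \<xi>] by (rule order_trans[OF sum_abs])
    qed
    then show ?thesis by blast
  qed
  obtain B1 B2 where "\<forall>\<xi>\<in>Xi_upto M t. \<bar>u1 t \<xi> $ a\<bar> \<le> B1" "\<forall>\<xi>\<in>Xi_upto M t. \<bar>u2 t \<xi> $ a\<bar> \<le> B2"
    using bdd assms(1,2) by metis
  then show ?thesis by (intro bdd_aboveI2[where M = "B1 + B2"]) fastforce
qed

lemma Metric_space_policy_dist:
  fixes M :: "('x::finite, 'u::finite, 'g::finite, 'k::finite, 'm::finite) drmic"
  assumes box: "\<forall>t\<in>{1..horizon M}. \<forall>i. lower M t $ i < upper M t $ i"
  shows "Metric_space (N_u M) (policy_dist M)"
proof -
  let ?S = "\<lambda>u1 u2 t a. SUP \<xi>\<in>Xi_upto M t. \<bar>u1 t \<xi> $ a - u2 t \<xi> $ a :: real\<bar>"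
  have ne: "Xi_upto M t \<noteq> {}" if t: "t \<in> {1..horizon M}" for t
  proof -
    have "lower M s \<in> cbox (lower M s) (upper M s)" if "s \<in> {1..t}" for s
      using box t that by (fastforce simp: mem_box_cart intro: less_imp_le)
    then show ?thesis unfolding Xi_upto_def PiE_eq_empty_iff by blast
  qed
  have up: "\<bar>u1 t \<xi> $ a - u2 t \<xi> $ a\<bar> \<le> ?S u1 u2 t a"
    if "u1 \<in> N_u M" "u2 \<in> N_u M" "t \<in> {1..horizon M}" "\<xi> \<in> Xi_upto M t" for u1 u2 t \<xi> a
    using N_u_bdd[OF that(1-3)] that(4) by (intro cSUP_upper)
  have S0: "0 \<le> ?S u1 u2 t a"
    if "u1 \<in> N_u M" "u2 \<in> N_u M" "t \<in> {1..horizon M}" for u1 u2 t a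
    using up[OF that] ne[OF that(3)] by (meson abs_ge_zero all_not_in_conv order_trans)
  show ?thesis
  proof
    fix x y show "0 \<le> policy_dist M x y"
      unfolding policy_dist_def using S0 by (auto intro!: sum_nonneg)
  next
    fix x y show "policy_dist M x y = policy_dist M y x"
      by (simp add: policy_dist_def abs_minus_commute)
  next
    fix x y assume xy: "x \<in> N_u M" "y \<in> N_u M"
    show "policy_dist M x y = 0 \<longleftrightarrow> x = y"
    proof
      assume "policy_dist M x y = 0"
      then have "(\<Sum>t = 1..horizon M. \<Sum>a\<in>UNIV. ?S x y t a) = 0"
        using xy by (simp add: policy_dist_def)
      moreover have "\<And>t. t \<in> {1..horizon M} \<Longrightarrow> 0 \<le> (\<Sum>a\<in>UNIV. ?S x y t a)"
        using S0[OF xy] by (intro sum_nonneg)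
      ultimately have T: "(\<Sum>a\<in>UNIV. ?S x y t a) = 0" if "t \<in> {1..horizon M}" for t
        using that by (subst (asm) sum_nonneg_eq_0_iff) auto
      have S: "?S x y t a = 0" if t: "t \<in> {1..horizon M}" for t a
      proof -
        have "\<forall>a\<in>UNIV. ?S x y t a = 0"
          using T[OF t] by (subst (asm) sum_nonneg_eq_0_iff[OF finite S0[OF xy t]])
        then show ?thesis by simp
      qed
      have eq: "x t \<xi> = y t \<xi>" if "t \<in> {1..horizon M}" "\<xi> \<in> Xi_upto M t" for t \<xi>
        using up[OF xy that] S[OF that(1)] by (simp add: vec_eq_iff)
      have P: "x \<in> policies M" "y \<in> policies M" using xy by (auto simp: N_u_def)
      show "x = y"
      proof (rule PiE_ext[OF P[unfolded policies_def]])
        fix t assume t: "t \<in> {1..horizon M}"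
        have "x t \<in> Xi_upto M t \<rightarrow>\<^sub>E UNIV" "y t \<in> Xi_upto M t \<rightarrow>\<^sub>E UNIV"
          using P t unfolding policies_def by (auto dest: PiE_mem)
        then show "x t = y t" by (rule PiE_ext) (rule eq[OF t])
      qed
    next
      assume "x = y"
      then show "policy_dist M x y = 0"
        unfolding policy_dist_def using ne by (auto intro!: sum.neutral)
    qed
  next
    fix x y z assume xyz: "x \<in> N_u M" "y \<in> N_u M" "z \<in> N_u M"
    have "?S x z t a \<le> ?S x y t a + ?S y z t a" if t: "t \<in> {1..horizon M}" for t a
    proof (rule cSUP_least[OF ne[OF t]])
      fix \<xi> assume "\<xi> \<in> Xi_upto M t"
      then show "\<bar>x t \<xi> $ a - z t \<xi> $ a\<bar> \<le> ?S x y t a + ?S y z t a"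
        using up[OF xyz(1,2) t, of \<xi> a] up[OF xyz(2,3) t, of \<xi> a] by linarith
    qed
    then show "policy_dist M x z \<le> policy_dist M x y + policy_dist M y z"
      using xyz by (auto simp: policy_dist_def sum.distrib[symmetric] intro!: sum_mono)
  qed
qed

end

theory Submission
  imports Defs
begin

text \<open>
  The infimum over breakpoint choices with largest segment at least \<open>\<delta>\<close> grows with \<open>\<delta>\<close>, and every
  choice has a segment of positive length, so as \<open>\<delta>\<close> decreases to 0 the limit is the infimum over
  all breakpoint choices. This infimum has to be identified with the optimal value over additive
  policies.

  Lifted policies are additive (\<open>Pi_u_subset_N_u\<close>, \<open>Pi_g_subset_N_g\<close>), which gives one
  inequality. For the other, let \<open>(u, g)\<close> be additive and feasible. The integer part needs no
  approximation: a sum of indicators with breakpoints at all its jumps represents \<open>g\<close> exactly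
  (\<open>N_g_lifted\<close>). The continuous part is approximated uniformly by piecewise linear
  interpolation (\<open>N_u_nearly_lifted\<close>), but the interpolant of \<open>u\<close> may be infeasible. Here the
  interior of the feasible set enters. For fixed \<open>g\<close> the constraints are convex in the continuous
  policy, so if a ball of radius \<open>r\<close> around \<open>u\<^sub>0\<close> is feasible, then so is a neighbourhood of
  \<open>(1 - \<theta>) u + \<theta> u\<^sub>0\<close> whose size is proportional to \<open>\<theta> r\<close>. Interpolating this point finely
  enough yields a feasible lifted policy, and a small \<open>\<theta>\<close> keeps it close to \<open>u\<close>
  (\<open>feasible_lifted_approximation\<close>).

  It remains to see that the worst-case cost depends continuously on the continuous policy. The
  states and controls stay in a compact set and \<open>g\<close> has finitely many values, so uniform
  convergence of the policies carries over to the running costs on the support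
  (\<open>uniform_limit_run_cost\<close>). A uniform bound on the running cost bounds all expectations at once,
  hence also their supremum over the ambiguity set (\<open>J_le_add\<close>).
\<close>

section \<open>Step functions and interpolants on a partition\<close>

lemma partition_mono:
  fixes w :: "nat \<Rightarrow> real"
  assumes steps: "\<forall>j\<in>{1..p}. w (j - 1) \<le> w j" and "i \<le> j" "j \<le> p"
  shows "w i \<le> w j"
  using assms(2,3)
proof (induction j rule: dec_induct)
  case (step n)
  then show ?case using steps[rule_format, of "Suc n"] by fastforce
qed simp

lemma telescope: "(\<Sum>j = 1..n. f j - f (j - 1 :: nat)) = f n - (f 0 :: 'a::ab_group_add)"
  by (induction n) auto

text \<open>
  Below the right end point, at most the jumps at breakpoints up to \<open>x\<close> are counted, and they
  telescope to the value on the piece containing \<open>x\<close>. At the right end point the piece is the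
  degenerate one, which exists because the last inner breakpoint sits there.
\<close>

lemma step_function_eq_sum_jumps:
  fixes w :: "nat \<Rightarrow> real" and f :: "real \<Rightarrow> int"
  assumes steps: "\<forall>j\<in>{1..p}. w (j - 1) \<le> w j"
    and const: "\<And>j. j \<in> {1..p} \<Longrightarrow> f constant_on {w (j - 1)..<w j}"
    and last: "p \<ge> 1" "w (p - 1) = w p" and x: "w 0 \<le> x" "x \<le> w p"
  shows "f x = f (w 0) +
    (\<Sum>j = 1..p - 1. (f (w j) - f (w (j - 1))) * (if x < w j then 0 else 1))"
proof -
  have above: "(\<Sum>j = 1..n. (f (w j) - f (w (j - 1))) * (if x < w j then 0 else 1))
      = f (w n) - f (w 0)" if n: "n \<le> p" "w n \<le> x" for n
  proof -
    have "\<not> x < w j" if "j \<in> {1..n}" for j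
      using partition_mono[OF steps, of j n] that n by auto
    then show ?thesis using telescope[of "\<lambda>j. f (w j)" n] by simp
  qed
  have below: "f x = f (w 0) +
      (\<Sum>j = 1..n. (f (w j) - f (w (j - 1))) * (if x < w j then 0 else 1))"
    if "n \<le> p" "x < w n" for n
    using that
  proof (induction n)
    case 0
    then show ?case using x by simp
  next
    case (Suc n)
    show ?case
    proof (cases "x < w n")
      case True
      then show ?thesis using Suc by simp
    next
      case False
      have "f x = f (w n)"
        using const[of "Suc n"] Suc.prems False unfolding constant_on_def
        by (metis Suc_le_mono atLeastAtMost_iff atLeastLessThan_iff diff_Suc_1 le0 linorder_not_less
            order.trans One_nat_def order_le_less_trans order_refl)
      then show ?thesis using above[of n] Suc.prems False by simp
    qed
  qed
  show ?thesis
  proof (cases "x < w (p - 1)")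
    case True
    then show ?thesis using below[of "p - 1"] by simp
  next
    case False
    then have "x = w (p - 1)" using x last by simp
    then show ?thesis using above[of "p - 1"] by simp
  qed
qed

text \<open>
  The sum is the piecewise linear interpolant of \<open>f\<close> at the breakpoints: past a segment it has
  collected the full increment of \<open>f\<close>, and inside a segment its value is a convex combination of
  the values at the two ends. A degenerate segment has slope \<open>0 / 0 = 0\<close> and contributes nothing.
\<close>

lemma interpolant_close:
  fixes w :: "nat \<Rightarrow> real" and f :: "real \<Rightarrow> real"
  assumes steps: "\<forall>j\<in>{1..p}. w (j - 1) \<le> w j"
    and osc: "\<And>j x y. j \<in> {1..p} \<Longrightarrow> x \<in> {w (j - 1)..w j} \<Longrightarrow> y \<in> {w (j - 1)..w j} \<Longrightarrow>
      \<bar>f x - f y\<bar> \<le> e"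
    and x: "w 0 \<le> x" "x \<le> w p" and e: "0 \<le> e"
  shows "\<bar>f (w 0) + (\<Sum>j = 1..p. (f (w j) - f (w (j - 1))) / (w j - w (j - 1)) *
    max (min x (w j) - w (j - 1)) 0) - f x\<bar> \<le> e"
proof -
  let ?g = "\<lambda>j. (f (w j) - f (w (j - 1))) / (w j - w (j - 1)) * max (min x (w j) - w (j - 1)) 0"
  have above: "(\<Sum>j = 1..n. ?g j) = f (w n) - f (w 0)" if n: "n \<le> p" "w n \<le> x" for n
  proof -
    have "?g j = f (w j) - f (w (j - 1))" if j: "j \<in> {1..n}" for j
    proof -
      have "w (j - 1) \<le> w j" "w j \<le> x"
        using partition_mono[OF steps, of j n] steps j n by auto
      then show ?thesis by (cases "w (j - 1) = w j") auto
    qed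
    then show ?thesis using telescope[of "\<lambda>j. f (w j)" n] by simp
  qed
  have "\<bar>f (w 0) + (\<Sum>j = 1..n. ?g j) - f x\<bar> \<le> e" if "n \<le> p" "x \<le> w n" for n
    using that
  proof (induction n)
    case 0
    then have "x = w 0" using x by simp
    then show ?case using e by simp
  next
    case (Suc n)
    show ?case
    proof (cases "x \<le> w n")
      case True
      moreover have "w n \<le> w (Suc n)" using steps[rule_format, of "Suc n"] Suc.prems by simp
      ultimately show ?thesis using Suc by simp
    next
      case False
      define \<theta> where "\<theta> = (x - w n) / (w (Suc n) - w n)"
      have pos: "w (Suc n) - w n > 0" using False Suc.prems by simp
      have \<theta>: "0 \<le> \<theta>" "\<theta> \<le> 1" using False Suc.prems pos by (auto simp: \<theta>_def field_simps)
      have "?g (Suc n) = (f (w (Suc n)) - f (w n)) * \<theta>"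
        using False Suc.prems by (simp add: \<theta>_def)
      then have "f (w 0) + (\<Sum>j = 1..Suc n. ?g j) - f x
          = (1 - \<theta>) * (f (w n) - f x) + \<theta> * (f (w (Suc n)) - f x)"
        using above[of n] Suc.prems False by (simp add: algebra_simps)
      also have "\<bar>\<dots>\<bar> \<le> (1 - \<theta>) * e + \<theta> * e"
      proof -
        have "\<bar>f (w n) - f x\<bar> \<le> e" "\<bar>f (w (Suc n)) - f x\<bar> \<le> e"
          using osc[of "Suc n" _ x] Suc.prems False by auto
        then show ?thesis using \<theta>
          by (intro order_trans[OF abs_triangle_ineq] add_mono) (auto simp: abs_mult intro!: mult_left_mono)
      qed
      finally show ?thesis by (simp add: algebra_simps)
    qed
  qed
  then show ?thesis using x by blast
qed

text \<open>
  One breakpoint at the left end of every piece suffices, and one at \<open>v\<close> catches a jump at the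
  right end point.
\<close>

lemma PInt_breakpoint_set:
  assumes "f \<in> PInt l v" "l \<le> v"
  shows "\<exists>S. finite S \<and> S \<subseteq> {l..v} \<and> v \<in> S \<and>
    (\<forall>x y. l \<le> x \<and> x \<le> y \<and> y < v \<and> S \<inter> {x<..y} = {} \<longrightarrow> f x = f y)"
proof -
  obtain n :: nat and w where w: "w 0 = l" "w n = v"
    and pieces: "\<forall>i\<in>{1..n}. w (i - 1) \<le> w i \<and> f constant_on {w (i - 1)..<w i}"
    using assms(1) unfolding PInt_def by blast
  then have steps: "\<forall>i\<in>{1..n}. w (i - 1) \<le> w i"
    and const: "\<And>i. i \<in> {1..n} \<Longrightarrow> f constant_on {w (i - 1)..<w i}"
    by blast+
  show ?thesis
  proof (intro exI[of _ "w ` {..n}"] conjI allI impI; (elim conjE)?)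
    show "finite (w ` {..n})" "v \<in> w ` {..n}" using w by auto
    show "w ` {..n} \<subseteq> {l..v}"
      using w partition_mono[OF steps, of 0] partition_mono[OF steps, of _ n] by auto
    fix x y assume xy: "l \<le> x" "x \<le> y" "y < v" "w ` {..n} \<inter> {x<..y} = {}"
    define i where "i = (LEAST i. x < w i)"
    have ex: "x < w n" using xy w by simp
    then have i: "x < w i" "i \<le> n" by (auto simp: i_def intro: LeastI Least_le)
    have "i \<noteq> 0" using i w xy by (metis not_le)
    then have "w (i - 1) \<le> x" using not_less_Least[of "i - 1" "\<lambda>i. x < w i"] i_def by fastforce
    moreover have "y < w i" using xy(4) i by force
    ultimately show "f x = f y"
      using const[of i] i xy \<open>i \<noteq> 0\<close> unfolding constant_on_def
      by (metis One_nat_def Suc_leI atLeastAtMost_iff atLeastLessThan_iff bot_nat_0.not_eq_extremum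
          order.trans)
  qed
qed

lemma continuous_breakpoint_set:
  fixes f :: "real \<Rightarrow> real"
  assumes "continuous_on {l..v} f" "0 < e"
  shows "\<exists>S. finite S \<and> S \<subseteq> {l..v} \<and>
    (\<forall>x y. l \<le> x \<and> x \<le> y \<and> y \<le> v \<and> S \<inter> {x<..<y} = {} \<longrightarrow> \<bar>f x - f y\<bar> \<le> e)"
proof -
  have "uniformly_continuous_on {l..v} f"
    using assms by (intro compact_uniformly_continuous) auto
  then obtain d where d: "d > 0"
    "\<And>x y. x \<in> {l..v} \<Longrightarrow> y \<in> {l..v} \<Longrightarrow> dist y x < d \<Longrightarrow> dist (f y) (f x) < e"
    using assms(2) unfolding uniformly_continuous_on_def by meson
  \<comment> \<open>a mesh of half the continuity modulus puts a grid point strictly inside any interval of length \<open>d\<close>\<close>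
  define h where "h = d / 2"
  have h: "h > 0" using d by (simp add: h_def)
  define N where "N = nat \<lceil>(v - l) / h\<rceil>"
  let ?S = "(\<lambda>k. l + real k * h) ` {..N} \<inter> {l..v}"
  show ?thesis
  proof (intro exI[of _ ?S] conjI allI impI; (elim conjE)?)
    show "finite ?S" "?S \<subseteq> {l..v}" by auto
    fix x y assume xy: "l \<le> x" "x \<le> y" "y \<le> v" "?S \<inter> {x<..<y} = {}"
    have "y - x < d"
    proof (rule ccontr)
      assume big: "\<not> y - x < d"
      \<comment> \<open>the first grid point to the right of \<open>x\<close>\<close>
      define k where "k = nat (\<lfloor>(x - l) / h\<rfloor> + 1)"
      have f0: "\<lfloor>(x - l) / h\<rfloor> \<ge> 0" using xy h by simp
      have rk: "real k = real_of_int \<lfloor>(x - l) / h\<rfloor> + 1" using f0 by (simp add: k_def)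
      have "(x - l) / h < real k" "real k \<le> (x - l) / h + 1" unfolding rk by linarith+
      then have 1: "x < l + real k * h" "l + real k * h \<le> x + h" using h by (auto simp: field_simps)
      then have 2: "l + real k * h < y" using big h h_def by linarith
      then have "real k \<le> (v - l) / h" using xy h by (simp add: field_simps)
      then have "k \<le> N" unfolding N_def by linarith
      then show False using xy 1 2 by auto
    qed
    then have "dist x y < d" using xy by (simp add: dist_real_def)
    then have "dist (f x) (f y) < e" using d(2)[of y x] xy by auto
    then show "\<bar>f x - f y\<bar> \<le> e" by (simp add: dist_real_def)
  qed
qed

section \<open>Breakpoint choices\<close>

text \<open>
  Only the inner breakpoints count, because the two outer ones carry no indicator. A point at the
  right end of the support must therefore be matched by an inner breakpoint with that value.
\<close>

definition refines ::
  "('x::finite, 'u::finite, 'g::finite, 'k::finite, 'm::finite) drmic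
    \<Rightarrow> (nat \<Rightarrow> 'k \<Rightarrow> real set) \<Rightarrow> 'k breakpoints \<Rightarrow> bool" where
  "refines M S = (\<lambda>(p, w). \<forall>t\<in>{1..horizon M}. \<forall>i. S t i \<subseteq> w t i ` {1..p t i - 1})"

definition breakpoint_sets ::
  "('x::finite, 'u::finite, 'g::finite, 'k::finite, 'm::finite) drmic
    \<Rightarrow> (nat \<Rightarrow> 'k \<Rightarrow> real set) set" where
  "breakpoint_sets M =
     {S. \<forall>t\<in>{1..horizon M}. \<forall>i. finite (S t i) \<and> S t i \<subseteq> {lower M t $ i..upper M t $ i}}"

lemma breakpointsD:
  assumes "(p, w) \<in> breakpoint_choices M" "t \<in> {1..horizon M}"
  shows "p t i \<ge> 1" "w t i 0 = lower M t $ i" "w t i (p t i) = upper M t $ i"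
    "\<forall>j\<in>{1..p t i}. w t i (j - 1) \<le> w t i j"
  using assms by (auto simp: breakpoint_choices_def)

lemma refining_breakpoints_exist:
  fixes M :: "('x::finite, 'u::finite, 'g::finite, 'k::finite, 'm::finite) drmic"
  assumes support: "\<forall>t\<in>{1..horizon M}. \<forall>i. lower M t $ i < upper M t $ i"
    and S: "S \<in> breakpoint_sets M"
  obtains b where "b \<in> breakpoint_choices M" "refines M S b"
proof -
  define w where "w t i = (!) (lower M t $ i # sorted_list_of_set (S t i) @ [upper M t $ i])" for t i
  define p where "p t i = Suc (card (S t i))" for t i
  have *: "w t i 0 = lower M t $ i" "w t i (p t i) = upper M t $ i"
    "\<forall>j\<in>{1..p t i}. w t i (j - 1) \<le> w t i j" "S t i \<subseteq> w t i ` {1..p t i - 1}"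
    if t: "t \<in> {1..horizon M}" for t i
  proof -
    let ?L = "sorted_list_of_set (S t i)"
    have fin: "finite (S t i)" and sub: "S t i \<subseteq> {lower M t $ i..upper M t $ i}"
      using S t by (auto simp: breakpoint_sets_def)
    show "w t i 0 = lower M t $ i" "w t i (p t i) = upper M t $ i"
      by (auto simp: w_def p_def nth_append)
    have "sorted (lower M t $ i # ?L @ [upper M t $ i])"
      using fin sub support t by (force simp: sorted_append intro: less_imp_le)
    then show "\<forall>j\<in>{1..p t i}. w t i (j - 1) \<le> w t i j"
      unfolding w_def p_def by (intro ballI sorted_nth_mono) auto
    show "S t i \<subseteq> w t i ` {1..p t i - 1}"
    proof
      fix s assume "s \<in> S t i"
      then have "s \<in> set ?L" using fin by simp
      then obtain k where "k < length ?L" "?L ! k = s" by (auto simp: in_set_conv_nth)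
      then show "s \<in> w t i ` {1..p t i - 1}"
        by (intro image_eqI[of _ _ "Suc k"]) (auto simp: w_def p_def nth_append)
    qed
  qed
  show ?thesis
  proof
    show "(p, w) \<in> breakpoint_choices M"
      using * by (auto simp: breakpoint_choices_def p_def)
    show "refines M S (p, w)" using * by (auto simp: refines_def)
  qed
qed

lemma refines_mono:
  "refines M S b \<Longrightarrow> (\<And>t i. t \<in> {1..horizon M} \<Longrightarrow> S' t i \<subseteq> S t i) \<Longrightarrow> refines M S' b"
  by (fastforce simp: refines_def split: prod.splits)

text \<open>Every point of \<open>S\<close> is itself a breakpoint, and there is none between consecutive breakpoints.\<close>

lemma refines_gap:
  assumes b: "(p, w) \<in> breakpoint_choices M" and "refines M S (p, w)" and t: "t \<in> {1..horizon M}"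
    and j: "j \<in> {1..p t i}"
  shows "S t i \<inter> {w t i (j - 1)<..<w t i j} = {}"
proof -
  note mono = partition_mono[OF breakpointsD(4)[OF b t, of i]]
  have False if s: "s \<in> S t i" "w t i (j - 1) < s" "s < w t i j" for s
  proof -
    obtain k where k: "k \<in> {1..p t i - 1}" "s = w t i k"
      using assms s(1) unfolding refines_def by blast
    show False
    proof (cases "k \<le> j - 1")
      case True
      then show False using mono[of k "j - 1"] j s(2) k(2) by fastforce
    next
      case False
      then have "j \<le> k" "k \<le> p t i" using k by auto
      then show False using mono[of j k] s(3) k(2) by simp
    qed
  qed
  then show ?thesis by fastforce
qed

text \<open>The segments of one coordinate add up to the length of its support, so one of them is positive.\<close>

lemma largest_segment_pos:
  fixes M :: "('x::finite, 'u::finite, 'g::finite, 'k::finite, 'm::finite) drmic"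
  assumes horizon: "horizon M \<ge> 1"
    and support: "\<forall>t\<in>{1..horizon M}. \<forall>i. lower M t $ i < upper M t $ i"
    and b: "b \<in> breakpoint_choices M"
  shows "0 < largest_segment M b"
proof -
  obtain p w where [simp]: "b = (p, w)" by (cases b)
  have t: "1 \<in> {1..horizon M}" using horizon by simp
  note B = breakpointsD[OF b[simplified] t]
  let ?A = "{w t i j - w t i (j - 1) | t i j. t \<in> {1..horizon M} \<and> j \<in> {1..p t i}}"
  have "?A = (\<lambda>(t, i, j). w t i j - w t i (j - 1)) `
      (SIGMA t:{1..horizon M}. SIGMA i:UNIV. {1..p t i})"
    by (force simp: image_iff)
  then have fin: "finite ?A" by simp
  show ?thesis
  proof (rule ccontr)
    assume "\<not> ?thesis"
    then have neg: "a \<le> 0" if "a \<in> ?A" for a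
      using Max_ge[OF fin that] by (simp add: largest_segment_def)
    have "(\<Sum>j = 1..p 1 i. w 1 i j - w 1 i (j - 1)) \<le> 0" for i
      by (intro sum_nonpos neg) (use t in blast)
    then have "w 1 i (p 1 i) \<le> w 1 i 0" for i
      using telescope[of "w 1 i" "p 1 i"] by (metis diff_le_0_iff_le)
    then show False using B support t by (metis not_le)
  qed
qed

section \<open>Lifted policies are additive\<close>

lemma Xi_coord:
  assumes "\<xi> \<in> Xi_upto M t" "s \<in> {1..t}"
  shows "\<xi> s $ i \<in> {lower M s $ i..upper M s $ i}"
proof -
  have "\<xi> s \<in> cbox (lower M s) (upper M s)" using assms by (auto simp: Xi_upto_def PiE_iff)
  then show ?thesis by (auto simp: mem_box_cart)
qed

lemma Xi_restrict: "\<xi> \<in> Xi M \<Longrightarrow> t \<le> horizon M \<Longrightarrow> restrict \<xi> {1..t} \<in> Xi_upto M t"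
  by (auto simp: Xi_upto_def PiE_iff)

lemma sum_idxV:
  "(\<Sum>(s, i, j)\<in>idxV (p, w) t. h s i j) = (\<Sum>s = 1..t. \<Sum>i\<in>(UNIV::'k::finite set). \<Sum>j = 1..p s i. h s i j)"
proof -
  have "idxV (p, w) t = (SIGMA s:{1..t}. SIGMA i:UNIV. {1..p s i})" by (auto simp: idxV_def)
  then show ?thesis by (simp add: sum.Sigma split_def)
qed

lemma sum_idxQ:
  "(\<Sum>(s, i, j)\<in>idxQ (p, w) t. h s i j) = (\<Sum>s = 1..t. \<Sum>i\<in>(UNIV::'k::finite set). \<Sum>j = 1..p s i - 1. h s i j)"
proof -
  have "idxQ (p, w) t = (SIGMA s:{1..t}. SIGMA i:UNIV. {1..p s i - 1})" by (auto simp: idxQ_def)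
  then show ?thesis by (simp add: sum.Sigma split_def)
qed

text \<open>
  An additive policy has no separate constant term; the constant is charged to one coordinate.
\<close>

lemma sum_one_coordinate:
  fixes c :: "'a::comm_monoid_add"
  assumes "t \<ge> (1::nat)"
  shows "(\<Sum>s = 1..t. \<Sum>i\<in>(UNIV::'k::finite set). h s i + (if s = 1 \<and> i = i0 then c else 0))
    = (\<Sum>s = 1..t. \<Sum>i\<in>UNIV. h s i) + c"
proof -
  have "(\<Sum>i\<in>(UNIV::'k set). if s = 1 \<and> i = i0 then c else 0) = (if s = 1 then c else 0)" for s :: nat
    by simp
  then show ?thesis using assms by (simp add: sum.distrib)
qed

lemma continuous_liftV: "continuous_on A (liftV b s i j)"
  by (cases b; cases "j = 1") (auto simp: liftV_def intro!: continuous_intros)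

lemma Pi_u_subset_N_u:
  fixes M :: "('x::finite, 'u::finite, 'g::finite, 'k::finite, 'm::finite) drmic"
  shows "Pi_u M b \<subseteq> N_u M"
proof
  fix u assume u: "u \<in> Pi_u M b"
  obtain p w where b: "b = (p, w)" by (cases b)
  show "u \<in> N_u M" unfolding N_u_def
  proof (intro CollectI conjI ballI allI)
    show "u \<in> policies M" using u by (simp add: Pi_u_def)
    fix t a assume t: "t \<in> {1..horizon M}"
    obtain Y y0 where eq: "\<forall>\<xi>\<in>Xi_upto M t. \<forall>a. u t \<xi> $ a =
        (\<Sum>(s, i, j)\<in>idxV b t. Y a (s, i, j) * liftV b s i j (\<xi> s $ i)) + y0 $ a"
      using u t unfolding Pi_u_def by blast
    \<comment> \<open>\<open>undefined\<close> stands for an arbitrary coordinate of the disturbance\<close>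
    let ?f = "\<lambda>s i x. (\<Sum>j = 1..p s i. Y a (s, i, j) * liftV b s i j x) +
      (if s = 1 \<and> i = (undefined :: 'k) then y0 $ a else 0)"
    have "continuous_on {lower M s $ i..upper M s $ i} (?f s i)" for s i
      by (intro continuous_intros continuous_liftV)
    moreover have "u t \<xi> $ a = (\<Sum>s = 1..t. \<Sum>i\<in>UNIV. ?f s i (\<xi> s $ i))" if "\<xi> \<in> Xi_upto M t" for \<xi>
      using eq that t unfolding b by (subst sum_one_coordinate) (auto simp: sum_idxV)
    ultimately show "\<exists>f. (\<forall>s\<in>{1..t}. \<forall>i. continuous_on {lower M s $ i..upper M s $ i} (f s i)) \<and>
        (\<forall>\<xi>\<in>Xi_upto M t. u t \<xi> $ a = (\<Sum>s = 1..t. \<Sum>i\<in>UNIV. f s i (\<xi> s $ i)))"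
      by (intro exI[of _ ?f]) blast
  qed
qed

lemma Pi_g_subset_N_g:
  fixes M :: "('x::finite, 'u::finite, 'g::finite, 'k::finite, 'm::finite) drmic"
  assumes b: "b \<in> breakpoint_choices M"
  shows "Pi_g M b \<subseteq> N_g M"
proof
  fix g assume g: "g \<in> Pi_g M b"
  obtain p w where pw: "b = (p, w)" by (cases b)
  show "g \<in> N_g M" unfolding N_g_def
  proof (intro CollectI conjI ballI allI)
    show "g \<in> policies M" using g by (simp add: Pi_g_def)
    fix t a assume t: "t \<in> {1..horizon M}"
    obtain Z z0 where eq: "\<forall>\<xi>\<in>Xi_upto M t. \<forall>a. g t \<xi> $ a =
        (\<Sum>(s, i, j)\<in>idxQ b t. Z a (s, i, j) * liftQ b s i j (\<xi> s $ i)) + z0 $ a"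
      using g t unfolding Pi_g_def by blast
    \<comment> \<open>\<open>undefined\<close> stands for an arbitrary coordinate of the disturbance\<close>
    let ?f = "\<lambda>s i x. (\<Sum>j = 1..p s i - 1. Z a (s, i, j) * liftQ b s i j x) +
      (if s = 1 \<and> i = (undefined :: 'k) then z0 $ a else 0)"
    have "?f s i \<in> PInt (lower M s $ i) (upper M s $ i)" if "s \<in> {1..t}" for s i
    proof -
      have s: "s \<in> {1..horizon M}" using that t by simp
      note B = breakpointsD[OF b[unfolded pw] s, of i]
      note mono = partition_mono[OF B(4)]
      have "?f s i constant_on {w s i (n - 1)..<w s i n}" if n: "n \<in> {1..p s i}" for n
      proof -
        have "liftQ b s i j x = (if j < n then 1 else 0)"
          if x: "x \<in> {w s i (n - 1)..<w s i n}" and j: "j \<in> {1..p s i - 1}" for x j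
          using mono[of j "n - 1"] mono[of n j] x j n unfolding pw liftQ_def by force
        then have "?f s i x = (\<Sum>j = 1..p s i - 1. Z a (s, i, j) * (if j < n then 1 else 0)) +
            (if s = 1 \<and> i = undefined then z0 $ a else 0)" if "x \<in> {w s i (n - 1)..<w s i n}" for x
          using that by (intro arg_cong2[where f = "(+)"] sum.cong refl) simp
        then show ?thesis unfolding constant_on_def by blast
      qed
      then show ?thesis
        unfolding PInt_def using B by (intro CollectI exI[of _ "p s i"] exI[of _ "w s i"]) blast
    qed
    moreover have "g t \<xi> $ a = (\<Sum>s = 1..t. \<Sum>i\<in>UNIV. ?f s i (\<xi> s $ i))" if "\<xi> \<in> Xi_upto M t" for \<xi>
      using eq that t unfolding pw by (subst sum_one_coordinate) (auto simp: sum_idxQ)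
    ultimately show "\<exists>f. (\<forall>s\<in>{1..t}. \<forall>i. f s i \<in> PInt (lower M s $ i) (upper M s $ i)) \<and>
        (\<forall>\<xi>\<in>Xi_upto M t. g t \<xi> $ a = (\<Sum>s = 1..t. \<Sum>i\<in>UNIV. f s i (\<xi> s $ i)))"
      by (intro exI[of _ ?f]) blast
  qed
qed

section \<open>Additive policies are lifted or nearly lifted\<close>

text \<open>
  A step function remains one on every finer partition, so the union of the finitely many
  breakpoint sets of all summands serves all times and components of the policy at once.
\<close>

lemma N_g_lifted:
  fixes M :: "('x::finite, 'u::finite, 'g::finite, 'k::finite, 'm::finite) drmic"
  assumes support: "\<forall>t\<in>{1..horizon M}. \<forall>i. lower M t $ i < upper M t $ i"
    and g: "g \<in> N_g M"
  obtains S where "S \<in> breakpoint_sets M"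
    "\<And>b. b \<in> breakpoint_choices M \<Longrightarrow> refines M S b \<Longrightarrow> g \<in> Pi_g M b"
proof -
  let ?l = "\<lambda>s i. lower M s $ i" and ?v = "\<lambda>s i. upper M s $ i"
  have "\<forall>t\<in>{1..horizon M}. \<forall>a. \<exists>f :: nat \<Rightarrow> 'k \<Rightarrow> real \<Rightarrow> int.
      (\<forall>s\<in>{1..t}. \<forall>i. f s i \<in> PInt (?l s i) (?v s i)) \<and>
      (\<forall>\<xi>\<in>Xi_upto M t. g t \<xi> $ a = (\<Sum>s = 1..t. \<Sum>i\<in>UNIV. f s i (\<xi> s $ i)))"
    using g by (simp add: N_g_def)
  then obtain f :: "nat \<Rightarrow> 'g \<Rightarrow> nat \<Rightarrow> 'k \<Rightarrow> real \<Rightarrow> int" where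
    "\<forall>t\<in>{1..horizon M}. \<forall>a. (\<forall>s\<in>{1..t}. \<forall>i. f t a s i \<in> PInt (?l s i) (?v s i)) \<and>
      (\<forall>\<xi>\<in>Xi_upto M t. g t \<xi> $ a = (\<Sum>s = 1..t. \<Sum>i\<in>UNIV. f t a s i (\<xi> s $ i)))"
    unfolding choice_iff bchoice_iff by blast
  then have f: "\<And>t a s i. t \<in> {1..horizon M} \<Longrightarrow> s \<in> {1..t} \<Longrightarrow> f t a s i \<in> PInt (?l s i) (?v s i)"
    and g_eq: "\<And>t a \<xi>. t \<in> {1..horizon M} \<Longrightarrow> \<xi> \<in> Xi_upto M t \<Longrightarrow>
      g t \<xi> $ a = (\<Sum>s = 1..t. \<Sum>i\<in>UNIV. f t a s i (\<xi> s $ i))"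
    by blast+
  have "\<forall>t\<in>{1..horizon M}. \<forall>a. \<forall>s\<in>{1..t}. \<forall>i. \<exists>S. finite S \<and> S \<subseteq> {?l s i..?v s i} \<and> ?v s i \<in> S \<and>
      (\<forall>x y. ?l s i \<le> x \<and> x \<le> y \<and> y < ?v s i \<and> S \<inter> {x<..y} = {} \<longrightarrow> f t a s i x = f t a s i y)"
  proof (intro ballI allI)
    fix t a s i assume t: "t \<in> {1..horizon M}" and s: "s \<in> {1..t}"
    then have "?l s i \<le> ?v s i" using support by (simp add: less_imp_le)
    then show "\<exists>S. finite S \<and> S \<subseteq> {?l s i..?v s i} \<and> ?v s i \<in> S \<and>
        (\<forall>x y. ?l s i \<le> x \<and> x \<le> y \<and> y < ?v s i \<and> S \<inter> {x<..y} = {} \<longrightarrow> f t a s i x = f t a s i y)"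
      by (rule PInt_breakpoint_set[OF f[OF t s]])
  qed
  then obtain S0 where
    "\<forall>t\<in>{1..horizon M}. \<forall>a. \<forall>s\<in>{1..t}. \<forall>i. finite (S0 t a s i) \<and> S0 t a s i \<subseteq> {?l s i..?v s i} \<and>
      ?v s i \<in> S0 t a s i \<and>
      (\<forall>x y. ?l s i \<le> x \<and> x \<le> y \<and> y < ?v s i \<and> S0 t a s i \<inter> {x<..y} = {} \<longrightarrow> f t a s i x = f t a s i y)"
    unfolding choice_iff bchoice_iff by blast
  then have S0: "\<And>t a s i. t \<in> {1..horizon M} \<Longrightarrow> s \<in> {1..t} \<Longrightarrow>
      finite (S0 t a s i) \<and> S0 t a s i \<subseteq> {?l s i..?v s i} \<and> ?v s i \<in> S0 t a s i"
    and const: "\<And>t a s i x y. t \<in> {1..horizon M} \<Longrightarrow> s \<in> {1..t} \<Longrightarrow>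
      ?l s i \<le> x \<Longrightarrow> x \<le> y \<Longrightarrow> y < ?v s i \<Longrightarrow> S0 t a s i \<inter> {x<..y} = {} \<Longrightarrow> f t a s i x = f t a s i y"
    by blast+
  define S where "S s i = (\<Union>t\<in>{s..horizon M}. \<Union>a. S0 t a s i)" for s i
  show ?thesis
  proof
    have "finite (S s i)" "S s i \<subseteq> {?l s i..?v s i}" if "s \<in> {1..horizon M}" for s i
    proof -
      have "\<forall>t\<in>{s..horizon M}. \<forall>a. finite (S0 t a s i) \<and> S0 t a s i \<subseteq> {?l s i..?v s i}"
        using S0[of _ s] that by simp
      then show "finite (S s i)" "S s i \<subseteq> {?l s i..?v s i}" unfolding S_def by auto
    qed
    then show "S \<in> breakpoint_sets M" by (simp add: breakpoint_sets_def)
    fix b assume b: "b \<in> breakpoint_choices M" and ref: "refines M S b"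
    obtain p w where pw: "b = (p, w)" by (cases b)
    have f_eq: "f t a s i x = f t a s i (?l s i) + (\<Sum>j = 1..p s i - 1.
        (f t a s i (w s i j) - f t a s i (w s i (j - 1))) * liftQ b s i j x)"
      if t: "t \<in> {1..horizon M}" and s: "s \<in> {1..t}" and x: "x \<in> {?l s i..?v s i}" for t a s i x
    proof -
      have s': "s \<in> {1..horizon M}" using s t by simp
      note B = breakpointsD[OF b[unfolded pw] s', of i]
      note mono = partition_mono[OF B(4)]
      have sub: "S0 t a s i \<subseteq> S s i" using s t by (force simp: S_def)
      have const': "f t a s i constant_on {w s i (j - 1)..<w s i j}" if j: "j \<in> {1..p s i}" for j
      proof -
        have "f t a s i (w s i (j - 1)) = f t a s i y" if y: "y \<in> {w s i (j - 1)..<w s i j}" for y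
        proof (rule const[OF t s])
          show "S0 t a s i \<inter> {w s i (j - 1)<..y} = {}"
            using refines_gap[OF b[unfolded pw] ref[unfolded pw] s' j] sub y by fastforce
        qed (use y j mono[of 0 "j - 1"] mono[of j "p s i"] B in auto)
        then show ?thesis unfolding constant_on_def by metis
      qed
      have "?v s i \<in> S s i" using S0[OF t s] sub by blast
      then obtain k where k: "k \<in> {1..p s i - 1}" "?v s i = w s i k"
        using ref s' unfolding refines_def pw by blast
      have "w s i (p s i - 1) = w s i (p s i)"
        using mono[of k "p s i - 1"] mono[of "p s i - 1" "p s i"] k B by simp
      from step_function_eq_sum_jumps[OF B(4) const' B(1) this, of x] x B
      show ?thesis by (simp add: pw liftQ_def)
    qed
    show "g \<in> Pi_g M b" unfolding Pi_g_def
    proof (intro CollectI conjI ballI)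
      show "g \<in> policies M" using g by (simp add: N_g_def)
      fix t assume t: "t \<in> {1..horizon M}"
      define Z where "Z = (\<lambda>a (s, i, j). f t a s i (w s i j) - f t a s i (w s i (j - 1)))"
      define z0 :: "int^'g" where "z0 = (\<chi> a. \<Sum>s = 1..t. \<Sum>i\<in>UNIV. f t a s i (?l s i))"
      have "g t \<xi> $ a = (\<Sum>(s, i, j)\<in>idxQ b t. Z a (s, i, j) * liftQ b s i j (\<xi> s $ i)) + z0 $ a"
        if \<xi>: "\<xi> \<in> Xi_upto M t" for \<xi> a
      proof -
        have "g t \<xi> $ a = (\<Sum>s = 1..t. \<Sum>i\<in>UNIV. f t a s i (?l s i) + (\<Sum>j = 1..p s i - 1.
            (f t a s i (w s i j) - f t a s i (w s i (j - 1))) * liftQ b s i j (\<xi> s $ i)))"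
          unfolding g_eq[OF t \<xi>] by (intro sum.cong refl f_eq t Xi_coord[OF \<xi>])
        then show ?thesis unfolding pw sum_idxQ by (simp add: Z_def z0_def sum.distrib)
      qed
      then show "\<exists>Z z0. \<forall>\<xi>\<in>Xi_upto M t. \<forall>a. g t \<xi> $ a =
          (\<Sum>(s, i, j)\<in>idxQ b t. Z a (s, i, j) * liftQ b s i j (\<xi> s $ i)) + z0 $ a"
        by blast
    qed
  qed
qed

text \<open>
  A control at time \<open>t\<close> has \<open>t n\<^sub>\<xi>\<close> summands of one variable and their interpolation errors add up,
  so each summand is interpolated to within \<open>e / (t n\<^sub>\<xi>)\<close>.
\<close>

lemma N_u_nearly_lifted:
  fixes M :: "('x::finite, 'u::finite, 'g::finite, 'k::finite, 'm::finite) drmic"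
  assumes u: "u \<in> N_u M" and e: "0 < e"
  obtains S where "S \<in> breakpoint_sets M"
    "\<And>b. b \<in> breakpoint_choices M \<Longrightarrow> refines M S b \<Longrightarrow> \<exists>u'\<in>Pi_u M b.
      \<forall>t\<in>{1..horizon M}. \<forall>\<xi>\<in>Xi_upto M t. \<forall>a. \<bar>u' t \<xi> $ a - u t \<xi> $ a\<bar> \<le> e"
proof -
  let ?l = "\<lambda>s i. lower M s $ i" and ?v = "\<lambda>s i. upper M s $ i"
  define h where "h t = e / (real t * real CARD('k))" for t :: nat
  have h: "0 < h t" if "t \<in> {1..horizon M}" for t using e that by (simp add: h_def)
  have "\<forall>t\<in>{1..horizon M}. \<forall>a. \<exists>f :: nat \<Rightarrow> 'k \<Rightarrow> real \<Rightarrow> real.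
      (\<forall>s\<in>{1..t}. \<forall>i. continuous_on {?l s i..?v s i} (f s i)) \<and>
      (\<forall>\<xi>\<in>Xi_upto M t. u t \<xi> $ a = (\<Sum>s = 1..t. \<Sum>i\<in>UNIV. f s i (\<xi> s $ i)))"
    using u by (simp add: N_u_def)
  then obtain f :: "nat \<Rightarrow> 'u \<Rightarrow> nat \<Rightarrow> 'k \<Rightarrow> real \<Rightarrow> real" where
    "\<forall>t\<in>{1..horizon M}. \<forall>a. (\<forall>s\<in>{1..t}. \<forall>i. continuous_on {?l s i..?v s i} (f t a s i)) \<and>
      (\<forall>\<xi>\<in>Xi_upto M t. u t \<xi> $ a = (\<Sum>s = 1..t. \<Sum>i\<in>UNIV. f t a s i (\<xi> s $ i)))"
    unfolding choice_iff bchoice_iff by blast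
  then have f: "\<And>t a s i. t \<in> {1..horizon M} \<Longrightarrow> s \<in> {1..t} \<Longrightarrow> continuous_on {?l s i..?v s i} (f t a s i)"
    and u_eq: "\<And>t a \<xi>. t \<in> {1..horizon M} \<Longrightarrow> \<xi> \<in> Xi_upto M t \<Longrightarrow>
      u t \<xi> $ a = (\<Sum>s = 1..t. \<Sum>i\<in>UNIV. f t a s i (\<xi> s $ i))"
    by blast+
  have "\<forall>t\<in>{1..horizon M}. \<forall>a. \<forall>s\<in>{1..t}. \<forall>i. \<exists>S. finite S \<and> S \<subseteq> {?l s i..?v s i} \<and>
      (\<forall>x y. ?l s i \<le> x \<and> x \<le> y \<and> y \<le> ?v s i \<and> S \<inter> {x<..<y} = {} \<longrightarrow>
        \<bar>f t a s i x - f t a s i y\<bar> \<le> h t)"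
  proof (intro ballI allI)
    fix t a s i assume t: "t \<in> {1..horizon M}" and s: "s \<in> {1..t}"
    show "\<exists>S. finite S \<and> S \<subseteq> {?l s i..?v s i} \<and>
        (\<forall>x y. ?l s i \<le> x \<and> x \<le> y \<and> y \<le> ?v s i \<and> S \<inter> {x<..<y} = {} \<longrightarrow>
          \<bar>f t a s i x - f t a s i y\<bar> \<le> h t)"
      by (rule continuous_breakpoint_set[OF f[OF t s] h[OF t]])
  qed
  then obtain S0 where
    "\<forall>t\<in>{1..horizon M}. \<forall>a. \<forall>s\<in>{1..t}. \<forall>i. finite (S0 t a s i) \<and> S0 t a s i \<subseteq> {?l s i..?v s i} \<and>
      (\<forall>x y. ?l s i \<le> x \<and> x \<le> y \<and> y \<le> ?v s i \<and> S0 t a s i \<inter> {x<..<y} = {} \<longrightarrow>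
        \<bar>f t a s i x - f t a s i y\<bar> \<le> h t)"
    unfolding choice_iff bchoice_iff by blast
  then have S0: "\<And>t a s i. t \<in> {1..horizon M} \<Longrightarrow> s \<in> {1..t} \<Longrightarrow>
      finite (S0 t a s i) \<and> S0 t a s i \<subseteq> {?l s i..?v s i}"
    and osc: "\<And>t a s i x y. t \<in> {1..horizon M} \<Longrightarrow> s \<in> {1..t} \<Longrightarrow> ?l s i \<le> x \<Longrightarrow> x \<le> y \<Longrightarrow>
      y \<le> ?v s i \<Longrightarrow> S0 t a s i \<inter> {x<..<y} = {} \<Longrightarrow> \<bar>f t a s i x - f t a s i y\<bar> \<le> h t"
    by blast+
  define S where "S s i = (\<Union>t\<in>{s..horizon M}. \<Union>a. S0 t a s i)" for s i
  show ?thesis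
  proof
    have "finite (S s i)" "S s i \<subseteq> {?l s i..?v s i}" if "s \<in> {1..horizon M}" for s i
    proof -
      have "\<forall>t\<in>{s..horizon M}. \<forall>a. finite (S0 t a s i) \<and> S0 t a s i \<subseteq> {?l s i..?v s i}"
        using S0[of _ s] that by simp
      then show "finite (S s i)" "S s i \<subseteq> {?l s i..?v s i}" unfolding S_def by auto
    qed
    then show "S \<in> breakpoint_sets M" by (simp add: breakpoint_sets_def)
    fix b assume b: "b \<in> breakpoint_choices M" and ref: "refines M S b"
    obtain p w where pw: "b = (p, w)" by (cases b)
    define Y where "Y = (\<lambda>t a (s, i, j). (f t a s i (w s i j) - f t a s i (w s i (j - 1))) /
      (w s i j - w s i (j - 1)))"
    \<comment> \<open>the first lifted coordinate is \<open>min \<xi> w\<^sub>1\<close> instead of its increment over \<open>w\<^sub>0\<close>\<close>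
    define c where "c t a s i = f t a s i (?l s i) - Y t a (s, i, 1) * ?l s i" for t a s i
    define F where "F t a s i x = c t a s i + (\<Sum>j = 1..p s i. Y t a (s, i, j) * liftV b s i j x)"
      for t a s i x
    have close: "\<bar>F t a s i x - f t a s i x\<bar> \<le> h t"
      if t: "t \<in> {1..horizon M}" and s: "s \<in> {1..t}" and x: "x \<in> {?l s i..?v s i}" for t a s i x
    proof -
      have s': "s \<in> {1..horizon M}" using s t by simp
      note B = breakpointsD[OF b[unfolded pw] s', of i]
      note mono = partition_mono[OF B(4)]
      have sub: "S0 t a s i \<subseteq> S s i" using s t by (force simp: S_def)
      have osc': "\<bar>f t a s i y - f t a s i z\<bar> \<le> h t"
        if j: "j \<in> {1..p s i}" and yz: "y \<in> {w s i (j - 1)..w s i j}" "z \<in> {w s i (j - 1)..w s i j}" for j y z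
      proof -
        have in_range: "?l s i \<le> w s i (j - 1)" "w s i j \<le> ?v s i"
          using mono[of 0 "j - 1"] mono[of j "p s i"] B j by auto
        have "S0 t a s i \<inter> {w s i (j - 1)<..<w s i j} = {}"
          using refines_gap[OF b[unfolded pw] ref[unfolded pw] s' j] sub by blast
        then have "S0 t a s i \<inter> {y<..<z} = {}" "S0 t a s i \<inter> {z<..<y} = {}" using yz by fastforce+
        then show ?thesis
          using osc[OF t s, of i y z a] osc[OF t s, of i z y a] yz in_range
          by (cases "y \<le> z") (auto simp: abs_minus_commute)
      qed
      have "(\<Sum>j = 1..p s i. Y t a (s, i, j) * liftV b s i j x) =
          (\<Sum>j = 1..p s i. Y t a (s, i, j) * max (min x (w s i j) - w s i (j - 1)) 0 +
            (if j = 1 then Y t a (s, i, 1) * ?l s i else 0))"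
      proof (rule sum.cong)
        fix j assume "j \<in> {1..p s i}"
        show "Y t a (s, i, j) * liftV b s i j x = Y t a (s, i, j) * max (min x (w s i j) - w s i (j - 1)) 0 +
            (if j = 1 then Y t a (s, i, 1) * ?l s i else 0)"
          using B mono[of 0 1] x by (auto simp: liftV_def pw algebra_simps)
      qed simp
      also have "\<dots> = (\<Sum>j = 1..p s i. Y t a (s, i, j) * max (min x (w s i j) - w s i (j - 1)) 0) +
          Y t a (s, i, 1) * ?l s i"
        using B(1) by (simp add: sum.distrib)
      finally have "F t a s i x = f t a s i (w s i 0) + (\<Sum>j = 1..p s i. (f t a s i (w s i j) -
          f t a s i (w s i (j - 1))) / (w s i j - w s i (j - 1)) * max (min x (w s i j) - w s i (j - 1)) 0)"
        using B(2) by (simp add: F_def c_def Y_def)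
      moreover note interpolant_close[OF B(4) osc', where x = x]
      ultimately show ?thesis using B x h[OF t] by simp
    qed
    define u' where "u' = (\<lambda>t\<in>{1..horizon M}. \<lambda>\<xi>\<in>Xi_upto M t.
      (\<chi> a. \<Sum>s = 1..t. \<Sum>i\<in>UNIV. F t a s i (\<xi> s $ i)))"
    have u': "u' t \<xi> $ a = (\<Sum>s = 1..t. \<Sum>i\<in>UNIV. F t a s i (\<xi> s $ i))"
      if "t \<in> {1..horizon M}" "\<xi> \<in> Xi_upto M t" for t \<xi> a
      using that by (simp add: u'_def)
    have "u' \<in> Pi_u M b" unfolding Pi_u_def
    proof (intro CollectI conjI ballI)
      show "u' \<in> policies M" by (auto simp: u'_def policies_def)
      fix t assume t: "t \<in> {1..horizon M}"
      have "u' t \<xi> $ a = (\<Sum>(s, i, j)\<in>idxV b t. Y t a (s, i, j) * liftV b s i j (\<xi> s $ i)) +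
          (\<chi> a. \<Sum>s = 1..t. \<Sum>i\<in>UNIV. c t a s i) $ a" if \<xi>: "\<xi> \<in> Xi_upto M t" for \<xi> a
        unfolding u'[OF t \<xi>] unfolding pw sum_idxV by (simp add: F_def sum.distrib pw)
      then show "\<exists>Y (y0 :: real^'u). \<forall>\<xi>\<in>Xi_upto M t. \<forall>a. u' t \<xi> $ a =
          (\<Sum>(s, i, j)\<in>idxV b t. Y a (s, i, j) * liftV b s i j (\<xi> s $ i)) + y0 $ a"
        by blast
    qed
    moreover have "\<bar>u' t \<xi> $ a - u t \<xi> $ a\<bar> \<le> e"
      if t: "t \<in> {1..horizon M}" and \<xi>: "\<xi> \<in> Xi_upto M t" for t \<xi> a
    proof -
      have "\<bar>u' t \<xi> $ a - u t \<xi> $ a\<bar> = \<bar>\<Sum>s = 1..t. \<Sum>i\<in>UNIV. F t a s i (\<xi> s $ i) - f t a s i (\<xi> s $ i)\<bar>"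
        by (simp add: u'[OF t \<xi>] u_eq[OF t \<xi>] sum_subtractf)
      also have "\<dots> \<le> (\<Sum>s = 1..t. \<Sum>i\<in>(UNIV::'k set). h t)"
        using close[OF t] Xi_coord[OF \<xi>] by (intro order_trans[OF sum_abs] sum_mono) auto
      also have "\<dots> = e" using t by (simp add: h_def)
      finally show ?thesis .
    qed
    ultimately show "\<exists>u'\<in>Pi_u M b. \<forall>t\<in>{1..horizon M}. \<forall>\<xi>\<in>Xi_upto M t. \<forall>a.
        \<bar>u' t \<xi> $ a - u t \<xi> $ a\<bar> \<le> e"
      by blast
  qed
qed

section \<open>Moving into the interior of the feasible set\<close>

lemma Xi_upto_nonempty:
  fixes M :: "('x::finite, 'u::finite, 'g::finite, 'k::finite, 'm::finite) drmic"
  assumes "\<forall>t\<in>{1..horizon M}. \<forall>i. lower M t $ i < upper M t $ i" "t \<le> horizon M"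
  shows "Xi_upto M t \<noteq> {}"
proof -
  have "lower M s \<in> cbox (lower M s) (upper M s)" if "s \<in> {1..t}" for s
    using assms that by (fastforce simp: mem_box_cart intro: less_imp_le)
  then show ?thesis unfolding Xi_upto_def PiE_eq_empty_iff by blast
qed

definition lin_comb ::
  "('x::finite, 'u::finite, 'g::finite, 'k::finite, 'm::finite) drmic
    \<Rightarrow> real \<Rightarrow> ('k, 'u) upolicy \<Rightarrow> real \<Rightarrow> ('k, 'u) upolicy \<Rightarrow> ('k, 'u) upolicy" where
  "lin_comb M c u d v = (\<lambda>t\<in>{1..horizon M}. \<lambda>\<xi>\<in>Xi_upto M t. c *\<^sub>R u t \<xi> + d *\<^sub>R v t \<xi>)"

lemma lin_comb_apply:
  "t \<in> {1..horizon M} \<Longrightarrow> \<xi> \<in> Xi_upto M t \<Longrightarrow> lin_comb M c u d v t \<xi> = c *\<^sub>R u t \<xi> + d *\<^sub>R v t \<xi>"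
  by (simp add: lin_comb_def)

lemma lin_comb_in_N_u:
  fixes M :: "('x::finite, 'u::finite, 'g::finite, 'k::finite, 'm::finite) drmic"
  assumes "u \<in> N_u M" "v \<in> N_u M"
  shows "lin_comb M c u d v \<in> N_u M"
  unfolding N_u_def
proof (intro CollectI conjI ballI allI)
  show "lin_comb M c u d v \<in> policies M" by (auto simp: lin_comb_def policies_def)
  fix t a assume t: "t \<in> {1..horizon M}"
  obtain f f' where f: "\<forall>s\<in>{1..t}. \<forall>i. continuous_on {lower M s $ i..upper M s $ i} (f s i)"
      "\<forall>\<xi>\<in>Xi_upto M t. u t \<xi> $ a = (\<Sum>s = 1..t. \<Sum>i\<in>UNIV. f s i (\<xi> s $ i))"
    and f': "\<forall>s\<in>{1..t}. \<forall>i. continuous_on {lower M s $ i..upper M s $ i} (f' s i)"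
      "\<forall>\<xi>\<in>Xi_upto M t. v t \<xi> $ a = (\<Sum>s = 1..t. \<Sum>i\<in>UNIV. f' s i (\<xi> s $ i))"
    using assms t unfolding N_u_def by blast
  show "\<exists>f. (\<forall>s\<in>{1..t}. \<forall>i. continuous_on {lower M s $ i..upper M s $ i} (f s i)) \<and>
      (\<forall>\<xi>\<in>Xi_upto M t. lin_comb M c u d v t \<xi> $ a = (\<Sum>s = 1..t. \<Sum>i\<in>UNIV. f s i (\<xi> s $ i)))"
    using f f' by (intro exI[of _ "\<lambda>s i x. c * f s i x + d * f' s i x"] conjI ballI allI)
      (auto intro!: continuous_intros simp: lin_comb_apply[OF t] sum.distrib sum_distrib_left)
qed

lemma affine_convex:
  fixes A :: "real^'n^'m" and B :: "real^'l^'m"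
  shows "A *v ((1 - \<theta>) *\<^sub>R x + \<theta> *\<^sub>R y) + (B *v ((1 - \<theta>) *\<^sub>R u + \<theta> *\<^sub>R v) + c) =
    (1 - \<theta>) *\<^sub>R (A *v x + (B *v u + c)) + \<theta> *\<^sub>R (A *v y + (B *v v + c))"
  by (simp add: matrix_vector_right_distrib matrix_vector_mult_scaleR algebra_simps)

lemma state_convex:
  fixes M :: "('x::finite, 'u::finite, 'g::finite, 'k::finite, 'm::finite) drmic"
  assumes w: "\<And>t \<zeta>. t \<in> {1..horizon M} \<Longrightarrow> \<zeta> \<in> Xi_upto M t \<Longrightarrow>
      w t \<zeta> = (1 - \<theta>) *\<^sub>R u t \<zeta> + \<theta> *\<^sub>R v t \<zeta>"
    and \<xi>: "\<xi> \<in> Xi M" and "t \<le> horizon M"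
  shows "state M w g \<xi> t = (1 - \<theta>) *\<^sub>R state M u g \<xi> t + \<theta> *\<^sub>R state M v g \<xi> t"
  using assms(3)
proof (induction t)
  case 0
  then show ?case by (simp add: algebra_simps)
next
  case (Suc t)
  show ?case
  proof (cases "t = 0")
    case False
    have "w t (restrict \<xi> {1..t}) =
        (1 - \<theta>) *\<^sub>R u t (restrict \<xi> {1..t}) + \<theta> *\<^sub>R v t (restrict \<xi> {1..t})"
      using False Suc.prems by (intro w Xi_restrict[OF \<xi>]) auto
    then show ?thesis using Suc False
      by (simp add: affine_convex add.assoc)
  qed (use Suc in \<open>simp add: matrix_vector_right_distrib matrix_vector_mult_scaleR\<close>)
qed

text \<open>For a fixed integer policy, states and constraints are affine in the continuous policy.\<close>

lemma feasible_convex: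
  fixes M :: "('x::finite, 'u::finite, 'g::finite, 'k::finite, 'm::finite) drmic"
  assumes w: "\<And>t \<zeta>. t \<in> {1..horizon M} \<Longrightarrow> \<zeta> \<in> Xi_upto M t \<Longrightarrow>
      w t \<zeta> = (1 - \<theta>) *\<^sub>R u t \<zeta> + \<theta> *\<^sub>R v t \<zeta>"
    and \<theta>: "0 \<le> \<theta>" "\<theta> \<le> 1" and feas: "feasible M u g" "feasible M v g"
  shows "feasible M w g"
  unfolding feasible_def
proof (intro ballI allI)
  fix \<xi> r assume \<xi>: "\<xi> \<in> Xi M"
  let ?c = "\<lambda>u t. conA M t *v state M u g \<xi> t + conB M t *v u t (restrict \<xi> {1..t}) +
    conC M t *v real_vec (g t (restrict \<xi> {1..t})) + conD M t *v \<xi> t"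
  have "?c w t = (1 - \<theta>) *\<^sub>R ?c u t + \<theta> *\<^sub>R ?c v t" if t: "t \<in> {1..horizon M}" for t
  proof -
    have "restrict \<xi> {1..t} \<in> Xi_upto M t" using \<xi> t by (intro Xi_restrict) auto
    moreover have "state M w g \<xi> t = (1 - \<theta>) *\<^sub>R state M u g \<xi> t + \<theta> *\<^sub>R state M v g \<xi> t"
      using t by (intro state_convex[OF _ \<xi>] w) auto
    ultimately show ?thesis using t by (simp add: w add.assoc) (rule affine_convex)
  qed
  then have "(\<Sum>t = 1..horizon M. ?c w t) =
      (\<Sum>t = 1..horizon M. (1 - \<theta>) *\<^sub>R ?c u t + \<theta> *\<^sub>R ?c v t)"
    by (intro sum.cong refl)
  also have "\<dots> = (1 - \<theta>) *\<^sub>R (\<Sum>t = 1..horizon M. ?c u t) + \<theta> *\<^sub>R (\<Sum>t = 1..horizon M. ?c v t)"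
    by (subst sum.distrib) (simp only: scaleR_sum_right)
  finally have "(\<Sum>t = 1..horizon M. ?c w t) $ r =
      (1 - \<theta>) * (\<Sum>t = 1..horizon M. ?c u t) $ r + \<theta> * (\<Sum>t = 1..horizon M. ?c v t) $ r"
    by (simp only: vector_add_component vector_scaleR_component real_scaleR_def)
  also have "\<dots> \<le> (1 - \<theta>) * rhs M $ r + \<theta> * rhs M $ r"
    using feas \<xi> \<theta> unfolding feasible_def by (intro add_mono mult_left_mono) auto
  finally show "(\<Sum>t = 1..horizon M. ?c w t) $ r \<le> rhs M $ r" by (simp add: algebra_simps)
qed

lemma policy_dist_upper:
  fixes M :: "('x::finite, 'u::finite, 'g::finite, 'k::finite, 'm::finite) drmic"
  assumes "u \<in> N_u M" "v \<in> N_u M" "t \<in> {1..horizon M}" "\<xi> \<in> Xi_upto M t"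
    and support: "\<forall>t\<in>{1..horizon M}. \<forall>i. lower M t $ i < upper M t $ i"
  shows "\<bar>u t \<xi> $ a - v t \<xi> $ a\<bar> \<le> policy_dist M u v"
proof -
  let ?S = "\<lambda>t a. SUP \<xi>\<in>Xi_upto M t. \<bar>u t \<xi> $ a - v t \<xi> $ a\<bar>"
  have up: "\<bar>u t \<xi> $ a - v t \<xi> $ a\<bar> \<le> ?S t a"
    if "t \<in> {1..horizon M}" "\<xi> \<in> Xi_upto M t" for t \<xi> a
    using N_u_bdd[OF assms(1,2) that(1)] that(2) by (rule cSUP_upper[rotated])
  have pos: "0 \<le> ?S t a" if "t \<in> {1..horizon M}" for t a
    using up[OF that] Xi_upto_nonempty[OF support, of t] that
    by (meson abs_ge_zero all_not_in_conv atLeastAtMost_iff order_trans)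
  have "?S t a \<le> (\<Sum>a\<in>UNIV. ?S t a)"
    using pos assms(3) by (intro member_le_sum) auto
  also have "\<dots> \<le> (\<Sum>t = 1..horizon M. \<Sum>a\<in>UNIV. ?S t a)"
    using pos assms(3) by (intro member_le_sum[of t] sum_nonneg) auto
  finally show ?thesis
    using up[OF assms(3,4), of a] assms(1,2) by (simp add: policy_dist_def)
qed

lemma policy_dist_le:
  fixes M :: "('x::finite, 'u::finite, 'g::finite, 'k::finite, 'm::finite) drmic"
  assumes "u \<in> N_u M" "v \<in> N_u M"
    and close: "\<And>t \<xi> a. t \<in> {1..horizon M} \<Longrightarrow> \<xi> \<in> Xi_upto M t \<Longrightarrow> \<bar>u t \<xi> $ a - v t \<xi> $ a\<bar> \<le> e"
    and support: "\<forall>t\<in>{1..horizon M}. \<forall>i. lower M t $ i < upper M t $ i"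
  shows "policy_dist M u v \<le> real (horizon M) * real CARD('u) * e"
proof -
  have "policy_dist M u v = (\<Sum>t = 1..horizon M. \<Sum>a\<in>UNIV. SUP \<xi>\<in>Xi_upto M t. \<bar>u t \<xi> $ a - v t \<xi> $ a\<bar>)"
    using assms(1,2) by (simp add: policy_dist_def)
  also have "\<dots> \<le> (\<Sum>t = 1..horizon M. \<Sum>a\<in>(UNIV :: 'u set). e)"
    by (intro sum_mono cSUP_least close Xi_upto_nonempty[OF support]) auto
  finally have "policy_dist M u v \<le> (\<Sum>t = 1..horizon M. \<Sum>a\<in>(UNIV :: 'u set). e)" .
  then show ?thesis by simp
qed

text \<open>
  If \<open>v\<close> is within \<open>e\<close> of \<open>(1 - \<theta>) u + \<theta> u\<^sub>0\<close>, then \<open>v = (1 - \<theta>) u + \<theta> h\<close> for a policy \<open>h\<close>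
  within \<open>e / \<theta>\<close> of \<open>u\<^sub>0\<close>, so \<open>v\<close> inherits feasibility from \<open>u\<close> and from the ball around \<open>u\<^sub>0\<close>.
\<close>

lemma feasible_near_segment:
  fixes M :: "('x::finite, 'u::finite, 'g::finite, 'k::finite, 'm::finite) drmic"
  assumes support: "\<forall>t\<in>{1..horizon M}. \<forall>i. lower M t $ i < upper M t $ i"
    and N: "u \<in> N_u M" "u0 \<in> N_u M" "v \<in> N_u M" and feas: "feasible M u g"
    and ball: "\<And>h. h \<in> N_u M \<Longrightarrow> policy_dist M h u0 < r \<Longrightarrow> feasible M h g"
    and \<theta>: "0 < \<theta>" "\<theta> \<le> 1"
    and close: "\<And>t \<xi> a. t \<in> {1..horizon M} \<Longrightarrow> \<xi> \<in> Xi_upto M t \<Longrightarrow>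
      \<bar>v t \<xi> $ a - ((1 - \<theta>) * u t \<xi> $ a + \<theta> * u0 t \<xi> $ a)\<bar> \<le> e"
    and e: "real (horizon M) * real CARD('u) * e < \<theta> * r"
  shows "feasible M v g"
proof -
  define h where "h = lin_comb M (1 / \<theta>) v (- (1 - \<theta>) / \<theta>) u"
  have h: "h \<in> N_u M" unfolding h_def using N by (intro lin_comb_in_N_u)
  have "\<bar>h t \<xi> $ a - u0 t \<xi> $ a\<bar> \<le> e / \<theta>" if "t \<in> {1..horizon M}" "\<xi> \<in> Xi_upto M t" for t \<xi> a
  proof -
    have "h t \<xi> $ a - u0 t \<xi> $ a = (v t \<xi> $ a - ((1 - \<theta>) * u t \<xi> $ a + \<theta> * u0 t \<xi> $ a)) / \<theta>"
      using \<theta> that by (simp add: h_def lin_comb_apply field_simps)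
    then show ?thesis using close[OF that, of a] \<theta> by (simp add: divide_right_mono)
  qed
  then have "policy_dist M h u0 \<le> real (horizon M) * real CARD('u) * (e / \<theta>)"
    using policy_dist_le[OF h N(2) _ support] by blast
  also have "\<dots> < r" using e \<theta> by (simp add: field_simps)
  finally have "feasible M h g" by (rule ball[OF h])
  moreover have "v t \<xi> = (1 - \<theta>) *\<^sub>R u t \<xi> + \<theta> *\<^sub>R h t \<xi>"
    if "t \<in> {1..horizon M}" "\<xi> \<in> Xi_upto M t" for t \<xi>
    using \<theta> that by (simp add: vec_eq_iff h_def lin_comb_apply field_simps)
  ultimately show ?thesis
    using feasible_convex[of M v \<theta> u h g] feas \<theta> by simp
qed

lemma interior_feasible_ball:
  fixes M :: "('x::finite, 'u::finite, 'g::finite, 'k::finite, 'm::finite) drmic"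
  assumes support: "\<forall>t\<in>{1..horizon M}. \<forall>i. lower M t $ i < upper M t $ i"
    and "Metric_space.mtopology (N_u M) (policy_dist M) interior_of feasible_u M g \<noteq> {}"
  obtains u0 r where "u0 \<in> N_u M" "0 < r"
    "\<And>h. h \<in> N_u M \<Longrightarrow> policy_dist M h u0 < r \<Longrightarrow> feasible M h g"
proof -
  interpret Metric_space "N_u M" "policy_dist M" by (rule Metric_space_policy_dist[OF support])
  obtain u0 where u0: "u0 \<in> mtopology interior_of feasible_u M g" using assms(2) by blast
  have "openin mtopology (mtopology interior_of feasible_u M g)" by simp
  then obtain r where r: "0 < r" "mball u0 r \<subseteq> mtopology interior_of feasible_u M g"
    and sub: "mtopology interior_of feasible_u M g \<subseteq> N_u M"
    using u0 unfolding openin_mtopology by blast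
  have ball: "mball u0 r \<subseteq> feasible_u M g" by (rule order_trans[OF r(2) interior_of_subset])
  show ?thesis
  proof
    show "u0 \<in> N_u M" "0 < r" using u0 sub r by auto
    fix h assume "h \<in> N_u M" "policy_dist M h u0 < r"
    then have "h \<in> mball u0 r" using u0 sub by (simp add: commute subset_iff)
    then show "feasible M h g" using ball by (auto simp: feasible_u_def)
  qed
qed

text \<open>
  A small step from \<open>u\<close> towards an interior point creates the slack in which the lifted
  approximation remains feasible, and costs only a small change of the policy.
\<close>

lemma feasible_lifted_approximation:
  fixes M :: "('x::finite, 'u::finite, 'g::finite, 'k::finite, 'm::finite) drmic"
  assumes horizon: "horizon M \<ge> 1"
    and support: "\<forall>t\<in>{1..horizon M}. \<forall>i. lower M t $ i < upper M t $ i"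
    and interior: "Metric_space.mtopology (N_u M) (policy_dist M) interior_of feasible_u M g \<noteq> {}"
    and u: "u \<in> N_u M" and g: "g \<in> N_g M" and feas: "feasible M u g" and e: "0 < e"
  obtains b v where "b \<in> breakpoint_choices M" "g \<in> Pi_g M b" "v \<in> Pi_u M b" "feasible M v g"
    "\<And>t \<xi> a. t \<in> {1..horizon M} \<Longrightarrow> \<xi> \<in> Xi_upto M t \<Longrightarrow> \<bar>v t \<xi> $ a - u t \<xi> $ a\<bar> \<le> e"
proof -
  obtain u0 r where u0: "u0 \<in> N_u M" and r: "0 < r"
    and ball: "\<And>h. h \<in> N_u M \<Longrightarrow> policy_dist M h u0 < r \<Longrightarrow> feasible M h g"
    using interior_feasible_ball[OF support interior] by blast
  define B where "B = policy_dist M u0 u"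
  interpret Metric_space "N_u M" "policy_dist M" by (rule Metric_space_policy_dist[OF support])
  have B0: "0 \<le> B" by (simp add: B_def)
  \<comment> \<open>\<open>\<theta>\<close> keeps the step towards \<open>u0\<close> below \<open>e / 2\<close>; \<open>\<eta>\<close> is the error that the ball around
    \<open>u0\<close>, scaled by \<open>\<theta>\<close>, absorbs, where \<open>K\<close> compares the distance with a componentwise bound\<close>
  define \<theta> where "\<theta> = min 1 (e / (2 * (B + 1)))"
  define K where "K = real (horizon M) * real CARD('u)"
  have K: "0 < K" using horizon by (simp add: K_def)
  define \<eta> where "\<eta> = min (e / 2) (\<theta> * r / (2 * K))"
  have \<theta>: "0 < \<theta>" "\<theta> \<le> 1" using e B0 by (auto simp: \<theta>_def)
  have "\<theta> * B \<le> e / (2 * (B + 1)) * B" using B0 by (intro mult_right_mono) (auto simp: \<theta>_def)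
  also have "\<dots> \<le> e / 2" using B0 e by (simp add: field_simps)
  finally have \<theta>B: "\<theta> * B \<le> e / 2" .
  have \<eta>: "0 < \<eta>" "\<eta> \<le> e / 2" using e \<theta> r K by (auto simp: \<eta>_def)
  have "K * \<eta> \<le> K * (\<theta> * r / (2 * K))" using K by (intro mult_left_mono) (auto simp: \<eta>_def)
  also have "\<dots> < \<theta> * r" using K \<theta> r by simp
  finally have K\<eta>: "K * \<eta> < \<theta> * r" .
  define m where "m = lin_comb M (1 - \<theta>) u \<theta> u0"
  have m: "m \<in> N_u M" unfolding m_def by (intro lin_comb_in_N_u u u0)
  obtain S1 where S1: "S1 \<in> breakpoint_sets M" "\<And>b. b \<in> breakpoint_choices M \<Longrightarrow>
      refines M S1 b \<Longrightarrow> \<exists>v\<in>Pi_u M b.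
        \<forall>t\<in>{1..horizon M}. \<forall>\<xi>\<in>Xi_upto M t. \<forall>a. \<bar>v t \<xi> $ a - m t \<xi> $ a\<bar> \<le> \<eta>"
    using N_u_nearly_lifted[OF m \<eta>(1)] by blast
  obtain S2 where S2: "S2 \<in> breakpoint_sets M"
    "\<And>b. b \<in> breakpoint_choices M \<Longrightarrow> refines M S2 b \<Longrightarrow> g \<in> Pi_g M b"
    using N_g_lifted[OF support g] by blast
  have "(\<lambda>t i. S1 t i \<union> S2 t i) \<in> breakpoint_sets M"
    using S1(1) S2(1) by (auto simp: breakpoint_sets_def)
  then obtain b where b: "b \<in> breakpoint_choices M" "refines M (\<lambda>t i. S1 t i \<union> S2 t i) b"
    using refining_breakpoints_exist[OF support] by blast
  then have "refines M S1 b" "refines M S2 b" by (auto elim: refines_mono)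
  then obtain v where g': "g \<in> Pi_g M b" and v: "v \<in> Pi_u M b"
    and vm: "\<And>t \<xi> a. t \<in> {1..horizon M} \<Longrightarrow> \<xi> \<in> Xi_upto M t \<Longrightarrow> \<bar>v t \<xi> $ a - m t \<xi> $ a\<bar> \<le> \<eta>"
    using S1(2) S2(2) b(1) by meson
  have v': "v \<in> N_u M" using v Pi_u_subset_N_u by blast
  have "feasible M v g"
  proof (rule feasible_near_segment[OF support u u0 v' feas ball \<theta>])
    fix t \<xi> a assume *: "t \<in> {1..horizon M}" "\<xi> \<in> Xi_upto M t"
    show "\<bar>v t \<xi> $ a - ((1 - \<theta>) * u t \<xi> $ a + \<theta> * u0 t \<xi> $ a)\<bar> \<le> \<eta>"
      using vm[OF *, of a] by (simp add: m_def lin_comb_apply[OF *])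
  qed (use K\<eta> in \<open>simp_all add: K_def\<close>)
  moreover have "\<bar>v t \<xi> $ a - u t \<xi> $ a\<bar> \<le> e" if *: "t \<in> {1..horizon M}" "\<xi> \<in> Xi_upto M t" for t \<xi> a
  proof -
    have "m t \<xi> $ a - u t \<xi> $ a = \<theta> * (u0 t \<xi> $ a - u t \<xi> $ a)"
      by (simp add: m_def lin_comb_apply[OF *] algebra_simps)
    then have "\<bar>m t \<xi> $ a - u t \<xi> $ a\<bar> \<le> \<theta> * B"
      using policy_dist_upper[OF u0 u * support, of a] \<theta> by (simp add: B_def abs_mult)
    then show ?thesis using vm[OF *, of a] \<theta>B \<eta> by linarith
  qed
  ultimately show ?thesis using that b(1) g' v by blast
qed

section \<open>Continuity of the running cost in the continuous policy\<close>

definition run_cost ::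
  "('x::finite, 'u::finite, 'g::finite, 'k::finite, 'm::finite) drmic
    \<Rightarrow> ('k, 'u) upolicy \<Rightarrow> ('k, 'g) gpolicy \<Rightarrow> 'k hist \<Rightarrow> real" where
  "run_cost M u g \<xi> = (\<Sum>t = 1..horizon M. discount M t *
     cost M t (state M u g \<xi> t) (u t (restrict \<xi> {1..t})) (g t (restrict \<xi> {1..t})))"

lemma bounded_matrix_mult:
  fixes A :: "real^'n^'m"
  shows "bounded (f ` S) \<Longrightarrow> bounded ((\<lambda>x. A *v f x) ` S)"
  using bounded_linear_image[OF _ matrix_vector_mul_bounded_linear, of "f ` S" A]
  by (simp add: image_image)

lemma bounded_continuous_image:
  fixes f :: "'a::heine_borel \<Rightarrow> 'b::metric_space"
  assumes "continuous_on UNIV f" "bounded S"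
  shows "bounded (f ` S)"
proof (rule bounded_subset)
  show "bounded (f ` closure S)"
    using assms by (intro compact_imp_bounded compact_continuous_image)
      (auto intro: continuous_on_subset simp: compact_closure)
  show "f ` S \<subseteq> f ` closure S" using closure_subset by blast
qed

lemma uniform_limit_continuous:
  fixes f :: "'a::heine_borel \<Rightarrow> 'b::metric_space"
  assumes f: "continuous_on UNIV f" and lim: "uniform_limit S g l F" and bdd: "bounded (l ` S)"
  shows "uniform_limit S (\<lambda>n x. f (g n x)) (\<lambda>x. f (l x)) F"
proof -
  obtain z B where B: "\<And>x. x \<in> S \<Longrightarrow> dist z (l x) \<le> B"
    using bdd unfolding bounded_def by blast
  have "uniform_limit S (\<lambda>n x. f (g n x)) (f \<circ> l) F"
  proof (rule uniform_limit_compose[OF lim])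
    show "uniformly_continuous_on (cball z (B + 1)) f"
      using f by (intro compact_uniformly_continuous) (auto intro: continuous_on_subset)
    have "\<forall>\<^sub>F n in F. \<forall>x\<in>S. dist (g n x) (l x) < 1" using uniform_limitD[OF lim] by simp
    then show "\<forall>\<^sub>F n in F. g n ` S \<subseteq> cball z (B + 1)"
    proof eventually_elim
      case (elim n)
      have "dist z (g n x) \<le> B + 1" if "x \<in> S" for x
        using B[OF that] elim that dist_triangle[of z "g n x" "l x"] by (force simp: dist_commute)
      then show ?case by auto
    qed
    show "l ` S \<subseteq> cball z (B + 1)" using B by fastforce
  qed
  then show ?thesis by (simp add: o_def)
qed

text \<open>
  Differences of additive policies are bounded, and \<open>lin_comb M 0 u 0 u\<close> is the zero policy.
\<close>

lemma bounded_upolicy: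
  fixes M :: "('x::finite, 'u::finite, 'g::finite, 'k::finite, 'm::finite) drmic"
  assumes u: "u \<in> N_u M" and t: "t \<in> {1..horizon M}"
  shows "bounded (u t ` Xi_upto M t)"
proof -
  have "\<exists>B. \<forall>\<xi>\<in>Xi_upto M t. \<bar>u t \<xi> $ a\<bar> \<le> B" for a
    using N_u_bdd[OF u lin_comb_in_N_u[OF u u] t, of a 0 0]
    by (auto simp: bdd_above_def lin_comb_apply[OF t])
  then obtain B where B: "\<And>a \<xi>. \<xi> \<in> Xi_upto M t \<Longrightarrow> \<bar>u t \<xi> $ a\<bar> \<le> B a" by metis
  have "norm (u t \<xi>) \<le> (\<Sum>a\<in>UNIV. B a)" if "\<xi> \<in> Xi_upto M t" for \<xi>
    by (intro order_trans[OF norm_le_l1_cart] sum_mono B that)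
  then show ?thesis unfolding bounded_iff by blast
qed

lemma bounded_upolicy_restrict:
  fixes M :: "('x::finite, 'u::finite, 'g::finite, 'k::finite, 'm::finite) drmic"
  assumes "u \<in> N_u M" "t \<in> {1..horizon M}"
  shows "bounded ((\<lambda>\<xi>. u t (restrict \<xi> {1..t})) ` Xi M)"
  using assms(2)
  by (intro bounded_subset[OF bounded_upolicy[OF assms]] image_subsetI imageI Xi_restrict) auto

lemma finite_range_gpolicy:
  fixes M :: "('x::finite, 'u::finite, 'g::finite, 'k::finite, 'm::finite) drmic"
  assumes g: "g \<in> Pi_g M b" and t: "t \<in> {1..horizon M}"
  shows "finite (g t ` Xi_upto M t)"
proof -
  obtain Z z0 where eq: "\<forall>\<xi>\<in>Xi_upto M t. \<forall>a. g t \<xi> $ a =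
      (\<Sum>(s, i, j)\<in>idxQ b t. Z a (s, i, j) * liftQ b s i j (\<xi> s $ i)) + z0 $ a"
    using g t unfolding Pi_g_def by blast
  define B where "B a = (\<Sum>(s, i, j)\<in>idxQ b t. \<bar>Z a (s, i, j)\<bar>) + \<bar>z0 $ a\<bar>" for a
  have bound: "\<bar>g t \<xi> $ a\<bar> \<le> B a" if \<xi>: "\<xi> \<in> Xi_upto M t" for \<xi> a
  proof -
    have "\<bar>\<Sum>(s, i, j)\<in>idxQ b t. Z a (s, i, j) * liftQ b s i j (\<xi> s $ i)\<bar>
        \<le> (\<Sum>(s, i, j)\<in>idxQ b t. \<bar>Z a (s, i, j)\<bar>)"
      by (intro order_trans[OF sum_abs] sum_mono) (auto simp: liftQ_def abs_mult split: prod.splits)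
    moreover have "g t \<xi> $ a =
        (\<Sum>(s, i, j)\<in>idxQ b t. Z a (s, i, j) * liftQ b s i j (\<xi> s $ i)) + z0 $ a"
      using eq \<xi> by blast
    ultimately show ?thesis unfolding B_def by linarith
  qed
  have "finite (Pi\<^sub>E UNIV (\<lambda>a::'g. {- B a..B a}))" by (intro finite_PiE) auto
  moreover have "g t ` Xi_upto M t \<subseteq> vec_lambda ` Pi\<^sub>E UNIV (\<lambda>a. {- B a..B a})"
  proof
    fix y assume "y \<in> g t ` Xi_upto M t"
    then have "\<bar>y $ a\<bar> \<le> B a" for a using bound by blast
    then have "- B a \<le> y $ a" "y $ a \<le> B a" for a by (smt (verit))+
    then have "vec_nth y \<in> Pi\<^sub>E UNIV (\<lambda>a. {- B a..B a})" by (simp add: PiE_iff)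
    then show "y \<in> vec_lambda ` Pi\<^sub>E UNIV (\<lambda>a. {- B a..B a})"
      by (rule image_eqI[rotated]) simp
  qed
  ultimately show ?thesis by (meson finite_imageI finite_subset)
qed

lemma finite_range_gpolicy_restrict:
  fixes M :: "('x::finite, 'u::finite, 'g::finite, 'k::finite, 'm::finite) drmic"
  assumes "g \<in> Pi_g M b" "t \<in> {1..horizon M}"
  shows "finite ((\<lambda>\<xi>. g t (restrict \<xi> {1..t})) ` Xi M)"
  using assms(2)
  by (intro finite_subset[OF _ finite_range_gpolicy[OF assms]] image_subsetI imageI Xi_restrict) auto

lemma bounded_state:
  fixes M :: "('x::finite, 'u::finite, 'g::finite, 'k::finite, 'm::finite) drmic"
  assumes u: "u \<in> N_u M" and g: "g \<in> Pi_g M b" and "t \<le> horizon M"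
  shows "bounded ((\<lambda>\<xi>. state M u g \<xi> t) ` Xi M)"
  using assms(3)
proof (induction t)
  case 0
  then show ?case by (auto intro!: finite_imp_bounded finite_subset[of _ "{init M}"])
next
  case (Suc t)
  show ?case
  proof (cases "t = 0")
    case True
    then show ?thesis using bounded_matrix_mult[OF Suc.IH] Suc.prems by simp
  next
    case False
    then have t: "t \<in> {1..horizon M}" using Suc.prems by simp
    have bg: "bounded ((\<lambda>\<xi>. real_vec (g t (restrict \<xi> {1..t}))) ` Xi M)"
      using finite_imageI[OF finite_range_gpolicy_restrict[OF g t], of real_vec]
      by (intro finite_imp_bounded) (simp add: image_image)
    have b\<xi>: "bounded ((\<lambda>\<xi>. \<xi> t) ` Xi M)"
      by (rule bounded_subset[OF bounded_cbox[of "lower M t" "upper M t"]])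
        (use t in \<open>auto simp: Xi_upto_def PiE_iff\<close>)
    have "bounded ((\<lambda>\<xi>. dynA M t *v state M u g \<xi> t + (dynB M t *v u t (restrict \<xi> {1..t}) +
        dynC M t *v real_vec (g t (restrict \<xi> {1..t})) + dynD M t *v \<xi> t)) ` Xi M)"
      using Suc.prems
      by (intro bounded_plus_comp bounded_matrix_mult Suc.IH bounded_upolicy_restrict[OF u t] bg b\<xi>) simp
    then show ?thesis using False by simp
  qed
qed

lemma bounded_state_control:
  fixes M :: "('x::finite, 'u::finite, 'g::finite, 'k::finite, 'm::finite) drmic"
  assumes "u \<in> N_u M" "g \<in> Pi_g M b" "t \<in> {1..horizon M}"
  shows "bounded ((\<lambda>\<xi>. (state M u g \<xi> t, u t (restrict \<xi> {1..t}))) ` Xi M)"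
proof (rule bounded_subset[OF bounded_Times])
  show "bounded ((\<lambda>\<xi>. state M u g \<xi> t) ` Xi M)"
    using assms by (intro bounded_state) auto
  show "bounded ((\<lambda>\<xi>. u t (restrict \<xi> {1..t})) ` Xi M)"
    using assms by (intro bounded_upolicy_restrict)
qed auto

lemma uniform_limit_upolicy_restrict:
  assumes "uniform_limit (Xi_upto M t) (\<lambda>n. us n t) (u t) F" "t \<in> {1..horizon M}"
  shows "uniform_limit (Xi M) (\<lambda>n \<xi>. us n t (restrict \<xi> {1..t})) (\<lambda>\<xi>. u t (restrict \<xi> {1..t})) F"
  using assms(2) by (intro uniform_limit_compose'[OF assms(1)] funcsetI Xi_restrict) auto

lemma uniform_limit_state:
  fixes M :: "('x::finite, 'u::finite, 'g::finite, 'k::finite, 'm::finite) drmic"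
  assumes lim: "\<And>t. t \<in> {1..horizon M} \<Longrightarrow> uniform_limit (Xi_upto M t) (\<lambda>n. us n t) (u t) F"
    and "t \<le> horizon M"
  shows "uniform_limit (Xi M) (\<lambda>n \<xi>. state M (us n) g \<xi> t) (\<lambda>\<xi>. state M u g \<xi> t) F"
  using assms(2)
proof (induction t)
  case 0
  show ?case by (simp add: uniform_limit_const)
next
  case (Suc t)
  note mult = bounded_linear.uniform_limit[OF matrix_vector_mul_bounded_linear]
  show ?case
  proof (cases "t = 0")
    case True
    then show ?thesis using Suc mult[OF Suc.IH] by simp
  next
    case False
    then have t: "t \<in> {1..horizon M}" using Suc.prems by simp
    have "uniform_limit (Xi M)
        (\<lambda>n \<xi>. dynA M t *v state M (us n) g \<xi> t + (dynB M t *v us n t (restrict \<xi> {1..t}) +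
          dynC M t *v real_vec (g t (restrict \<xi> {1..t})) + dynD M t *v \<xi> t))
        (\<lambda>\<xi>. dynA M t *v state M u g \<xi> t + (dynB M t *v u t (restrict \<xi> {1..t}) +
          dynC M t *v real_vec (g t (restrict \<xi> {1..t})) + dynD M t *v \<xi> t)) F"
      using Suc.prems
      by (intro uniform_limit_add mult Suc.IH uniform_limit_upolicy_restrict[where M = M and t = t and us = us and u = u and F = F, OF lim[OF t] t]
          uniform_limit_const) simp
    then show ?thesis using False by simp
  qed
qed

lemma uniform_limit_sum:
  fixes f :: "'i \<Rightarrow> 'n \<Rightarrow> 'a \<Rightarrow> 'b::real_normed_vector"
  assumes "finite I" "\<And>i. i \<in> I \<Longrightarrow> uniform_limit S (f i) (l i) F"
  shows "uniform_limit S (\<lambda>n x. \<Sum>i\<in>I. f i n x) (\<lambda>x. \<Sum>i\<in>I. l i x) F"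
  using assms by (induction I rule: finite_induct) (auto intro!: uniform_limit_add uniform_limit_const)

text \<open>
  The cost is only assumed continuous for each fixed integer control, so the limit is taken
  separately on the finitely many sets of disturbances on which that control is constant.
\<close>

lemma uniform_limit_run_cost:
  fixes M :: "('x::finite, 'u::finite, 'g::finite, 'k::finite, 'm::finite) drmic"
  assumes cost: "\<forall>t\<in>{1..horizon M}. \<forall>\<gamma>. continuous_on UNIV (\<lambda>(x, u). cost M t x u \<gamma>)"
    and lim: "\<And>t. t \<in> {1..horizon M} \<Longrightarrow> uniform_limit (Xi_upto M t) (\<lambda>n. us n t) (u t) F"
    and u: "u \<in> N_u M" and g: "g \<in> Pi_g M b"
  shows "uniform_limit (Xi M) (\<lambda>n. run_cost M (us n) g) (run_cost M u g) F"
  unfolding run_cost_def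
proof (intro uniform_limit_sum bounded_linear.uniform_limit[OF bounded_linear_mult_right])
  fix t assume t: "t \<in> {1..horizon M}"
  let ?g = "\<lambda>\<xi>. g t (restrict \<xi> {1..t})"
  let ?G = "?g ` Xi M"
  let ?Xu = "\<lambda>u \<xi>. (state M u g \<xi> t, u t (restrict \<xi> {1..t}))"
  let ?A = "\<lambda>\<gamma>. {\<xi>\<in>Xi M. ?g \<xi> = \<gamma>}"
  have pair: "uniform_limit (Xi M) (\<lambda>n. ?Xu (us n)) (?Xu u) F"
  proof (rule uniform_limitI)
    fix e :: real assume "0 < e"
    then have "0 < e / 2" by simp
    have "\<forall>\<^sub>F n in F. \<forall>\<xi>\<in>Xi M. dist (state M (us n) g \<xi> t) (state M u g \<xi> t) < e / 2"
      using t by (intro uniform_limitD[OF uniform_limit_state[OF lim] \<open>0 < e / 2\<close>]) auto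
    moreover have "\<forall>\<^sub>F n in F. \<forall>\<xi>\<in>Xi M.
        dist (us n t (restrict \<xi> {1..t})) (u t (restrict \<xi> {1..t})) < e / 2"
      by (rule uniform_limitD[OF uniform_limit_upolicy_restrict[where M = M and t = t and us = us and u = u and F = F, OF lim[OF t] t] \<open>0 < e / 2\<close>])
    ultimately show "\<forall>\<^sub>F n in F. \<forall>\<xi>\<in>Xi M. dist (?Xu (us n) \<xi>) (?Xu u \<xi>) < e"
    proof eventually_elim
      case (elim n)
      then show ?case
        by (fastforce simp: dist_Pair_Pair intro: order_le_less_trans[OF sqrt_sum_squares_le_sum_abs])
    qed
  qed
  have "uniform_limit (\<Union>(?A ` ?G)) (\<lambda>n \<xi>. cost M t (state M (us n) g \<xi> t) (us n t (restrict \<xi> {1..t})) (?g \<xi>))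
      (\<lambda>\<xi>. cost M t (state M u g \<xi> t) (u t (restrict \<xi> {1..t})) (?g \<xi>)) F"
  proof (rule uniform_limit_on_UNION[OF finite_range_gpolicy_restrict[OF g t]])
    fix \<gamma>
    have c: "continuous_on UNIV (\<lambda>z. cost M t (fst z) (snd z) \<gamma>)"
      using cost t by (simp add: case_prod_beta')
    have "uniform_limit (Xi M) (\<lambda>n \<xi>. cost M t (fst (?Xu (us n) \<xi>)) (snd (?Xu (us n) \<xi>)) \<gamma>)
        (\<lambda>\<xi>. cost M t (fst (?Xu u \<xi>)) (snd (?Xu u \<xi>)) \<gamma>) F"
      by (rule uniform_limit_continuous[OF c pair bounded_state_control[OF u g t]])
    then have "uniform_limit (?A \<gamma>) (\<lambda>n \<xi>. cost M t (state M (us n) g \<xi> t) (us n t (restrict \<xi> {1..t})) \<gamma>)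
        (\<lambda>\<xi>. cost M t (state M u g \<xi> t) (u t (restrict \<xi> {1..t})) \<gamma>) F"
      by (auto elim: uniform_limit_on_subset)
    then show "uniform_limit (?A \<gamma>)
        (\<lambda>n \<xi>. cost M t (state M (us n) g \<xi> t) (us n t (restrict \<xi> {1..t})) (?g \<xi>))
        (\<lambda>\<xi>. cost M t (state M u g \<xi> t) (u t (restrict \<xi> {1..t})) (?g \<xi>)) F"
      by (subst uniform_limit_cong') auto
  qed
  moreover have "\<Union>(?A ` ?G) = Xi M" by blast
  ultimately show "uniform_limit (Xi M)
      (\<lambda>n \<xi>. cost M t (state M (us n) g \<xi> t) (us n t (restrict \<xi> {1..t})) (?g \<xi>))
      (\<lambda>\<xi>. cost M t (state M u g \<xi> t) (u t (restrict \<xi> {1..t})) (?g \<xi>)) F"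
    by simp
qed simp

lemma bounded_run_cost:
  fixes M :: "('x::finite, 'u::finite, 'g::finite, 'k::finite, 'm::finite) drmic"
  assumes cost: "\<forall>t\<in>{1..horizon M}. \<forall>\<gamma>. continuous_on UNIV (\<lambda>(x, u). cost M t x u \<gamma>)"
    and u: "u \<in> N_u M" and g: "g \<in> Pi_g M b"
  shows "bounded (run_cost M u g ` Xi M)"
proof -
  have "\<exists>B. \<forall>\<xi>\<in>Xi M. \<bar>cost M t (state M u g \<xi> t) (u t (restrict \<xi> {1..t})) (g t (restrict \<xi> {1..t}))\<bar> \<le> B"
    if t: "t \<in> {1..horizon M}" for t
  proof -
    let ?Xu = "(\<lambda>\<xi>. (state M u g \<xi> t, u t (restrict \<xi> {1..t}))) ` Xi M"
    have "bounded ((\<lambda>(x, u). cost M t x u \<gamma>) ` ?Xu)" for \<gamma>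
      using cost t by (intro bounded_continuous_image bounded_state_control[OF u g t]) auto
    then have "bounded (\<Union>\<gamma>\<in>(\<lambda>\<xi>. g t (restrict \<xi> {1..t})) ` Xi M. (\<lambda>(x, u). cost M t x u \<gamma>) ` ?Xu)"
      by (intro bounded_UN finite_range_gpolicy_restrict[OF g t]) auto
    then show ?thesis unfolding bounded_iff by fastforce
  qed
  then obtain B where B: "\<And>t \<xi>. t \<in> {1..horizon M} \<Longrightarrow> \<xi> \<in> Xi M \<Longrightarrow>
      \<bar>cost M t (state M u g \<xi> t) (u t (restrict \<xi> {1..t})) (g t (restrict \<xi> {1..t}))\<bar> \<le> B t"
    by metis
  have "\<bar>run_cost M u g \<xi>\<bar> \<le> (\<Sum>t = 1..horizon M. \<bar>discount M t\<bar> * B t)" if "\<xi> \<in> Xi M" for \<xi>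
    unfolding run_cost_def using B that
    by (intro order_trans[OF sum_abs] sum_mono) (auto simp: abs_mult intro!: mult_left_mono)
  then show ?thesis unfolding bounded_iff by auto
qed

section \<open>Integrability of the running cost\<close>

abbreviation hist_algebra ::
  "('x::finite, 'u::finite, 'g::finite, 'k::finite, 'm::finite) drmic \<Rightarrow> 'k hist measure" where
  "hist_algebra M \<equiv> restrict_space (Pi\<^sub>M {1..horizon M} (\<lambda>_. borel)) (Xi M)"

lemma space_hist_algebra: "space (hist_algebra M) = Xi M"
  by (auto simp: space_restrict_space space_PiM Xi_upto_def PiE_iff)

lemma measurable_hist_component:
  "t \<in> {1..horizon M} \<Longrightarrow> (\<lambda>\<xi>. \<xi> t) \<in> borel_measurable (hist_algebra M)"
  by (intro measurable_restrict_space1 measurable_component_singleton)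

lemma measurable_continuous_compose:
  "continuous_on UNIV h \<Longrightarrow> f \<in> borel_measurable N \<Longrightarrow> (\<lambda>x. h (f x)) \<in> borel_measurable N"
  by (rule measurable_compose[OF _ borel_measurable_continuous_onI])

lemma measurable_hist_coord:
  "t \<in> {1..horizon M} \<Longrightarrow> (\<lambda>\<xi>. \<xi> t $ i) \<in> borel_measurable (hist_algebra M)"
  by (rule measurable_continuous_compose[OF _ measurable_hist_component]) (intro continuous_intros)

lemma borel_measurable_vecI:
  fixes f :: "'a \<Rightarrow> real^'n"
  assumes "\<And>a. (\<lambda>x. f x $ a) \<in> borel_measurable N"
  shows "f \<in> borel_measurable N"
proof (rule borel_measurable_euclidean_space[THEN iffD2], rule)
  fix i :: "real^'n" assume "i \<in> Basis"
  then obtain a where "i = axis a 1" unfolding Basis_vec_def Basis_real_def by blast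
  then show "(\<lambda>x. f x \<bullet> i) \<in> borel_measurable N" using assms[of a] by (simp add: inner_axis)
qed

text \<open>
  The summands of an additive policy are only controlled on the support, so they are composed with
  the projection onto it before measurability is invoked.
\<close>

lemma measurable_upolicy:
  fixes M :: "('x::finite, 'u::finite, 'g::finite, 'k::finite, 'm::finite) drmic"
  assumes u: "u \<in> N_u M" and t: "t \<in> {1..horizon M}"
  shows "(\<lambda>\<xi>. u t (restrict \<xi> {1..t})) \<in> borel_measurable (hist_algebra M)"
proof (rule borel_measurable_vecI)
  fix a
  obtain f where f: "\<And>s i. s \<in> {1..t} \<Longrightarrow> continuous_on {lower M s $ i..upper M s $ i} (f s i)"
    and eq: "\<And>\<xi>. \<xi> \<in> Xi_upto M t \<Longrightarrow> u t \<xi> $ a = (\<Sum>s = 1..t. \<Sum>i\<in>UNIV. f s i (\<xi> s $ i))"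
    using u t unfolding N_u_def by blast
  let ?c = "\<lambda>s i x. max (lower M s $ i) (min (upper M s $ i) x)"
  have "(\<lambda>\<xi>. f s i (?c s i (\<xi> s $ i))) \<in> borel_measurable (hist_algebra M)" if s: "s \<in> {1..t}" for s i
  proof (cases "lower M s $ i \<le> upper M s $ i")
    case True
    have "continuous_on UNIV (\<lambda>x. f s i (?c s i x))"
      by (rule continuous_on_compose2[OF f[OF s]]) (use True in \<open>auto intro!: continuous_intros\<close>)
    moreover have "(\<lambda>\<xi>. \<xi> s $ i) \<in> borel_measurable (hist_algebra M)"
      using s t by (intro measurable_hist_coord) auto
    ultimately show ?thesis by (rule measurable_continuous_compose)
  next
    case False
    then have "?c s i x = lower M s $ i" for x by auto
    then show ?thesis by simp
  qed
  then have "(\<lambda>\<xi>. \<Sum>s = 1..t. \<Sum>i\<in>UNIV. f s i (?c s i (\<xi> s $ i))) \<in> borel_measurable (hist_algebra M)"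
    by (intro borel_measurable_sum)
  moreover have "u t (restrict \<xi> {1..t}) $ a = (\<Sum>s = 1..t. \<Sum>i\<in>UNIV. f s i (?c s i (\<xi> s $ i)))"
    if \<xi>: "\<xi> \<in> space (hist_algebra M)" for \<xi>
  proof -
    have r: "restrict \<xi> {1..t} \<in> Xi_upto M t"
      using \<xi>[unfolded space_hist_algebra] t by (intro Xi_restrict) auto
    have "?c s i (\<xi> s $ i) = \<xi> s $ i" if "s \<in> {1..t}" for s i
      using Xi_coord[OF r that, of i] that by auto
    then show ?thesis unfolding eq[OF r] by (intro sum.cong) auto
  qed
  ultimately show "(\<lambda>\<xi>. u t (restrict \<xi> {1..t}) $ a) \<in> borel_measurable (hist_algebra M)"
    by (subst measurable_cong)
qed

lemma measurable_gpolicy_real: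
  fixes M :: "('x::finite, 'u::finite, 'g::finite, 'k::finite, 'm::finite) drmic"
  assumes g: "g \<in> Pi_g M b" and t: "t \<in> {1..horizon M}"
  shows "(\<lambda>\<xi>. real_of_int (g t (restrict \<xi> {1..t}) $ a)) \<in> borel_measurable (hist_algebra M)"
proof -
  obtain Z z0 where eq: "\<And>\<xi>. \<xi> \<in> Xi_upto M t \<Longrightarrow> g t \<xi> $ a =
      (\<Sum>(s, i, j)\<in>idxQ b t. Z a (s, i, j) * liftQ b s i j (\<xi> s $ i)) + z0 $ a"
    using g t unfolding Pi_g_def by fast
  have "(\<lambda>\<xi>. real_of_int (Z a k) * (case k of (s, i, j) \<Rightarrow> if \<xi> s $ i < snd b s i j then 0 else 1))
      \<in> borel_measurable (hist_algebra M)" if "k \<in> idxQ b t" for k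
  proof -
    obtain s i j where k: "k = (s, i, j)" by (cases k)
    have "(\<lambda>\<xi>. \<xi> s $ i) \<in> borel_measurable (hist_algebra M)"
      using that t by (intro measurable_hist_coord) (auto simp: k idxQ_def split: prod.splits)
    moreover have "(\<lambda>x. real_of_int (Z a k) * (if x < snd b s i j then 0 else 1)) \<in> borel_measurable borel"
      by measurable
    ultimately show ?thesis unfolding k prod.case by (rule measurable_compose)
  qed
  then have "(\<lambda>\<xi>. (\<Sum>k\<in>idxQ b t. real_of_int (Z a k) *
      (case k of (s, i, j) \<Rightarrow> if \<xi> s $ i < snd b s i j then 0 else 1)) + real_of_int (z0 $ a))
      \<in> borel_measurable (hist_algebra M)"
    by (intro borel_measurable_add borel_measurable_sum borel_measurable_const)
  moreover have "real_of_int (g t (restrict \<xi> {1..t}) $ a) = (\<Sum>k\<in>idxQ b t. real_of_int (Z a k) *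
      (case k of (s, i, j) \<Rightarrow> if \<xi> s $ i < snd b s i j then 0 else 1)) + real_of_int (z0 $ a)"
    if \<xi>: "\<xi> \<in> space (hist_algebra M)" for \<xi>
  proof -
    have r: "restrict \<xi> {1..t} \<in> Xi_upto M t"
      using \<xi>[unfolded space_hist_algebra] t by (intro Xi_restrict) auto
    show ?thesis unfolding eq[OF r]
      by (auto simp: liftQ_def idxQ_def split: prod.splits intro!: sum.cong)
  qed
  ultimately show ?thesis by (subst measurable_cong)
qed

lemma measurable_gpolicy:
  fixes M :: "('x::finite, 'u::finite, 'g::finite, 'k::finite, 'm::finite) drmic"
  assumes g: "g \<in> Pi_g M b" and t: "t \<in> {1..horizon M}"
  shows "(\<lambda>\<xi>. g t (restrict \<xi> {1..t})) \<in> measurable (hist_algebra M) (count_space UNIV)"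
proof -
  have "(\<lambda>\<xi>. g t (restrict \<xi> {1..t})) -` {\<gamma>} \<inter> space (hist_algebra M) \<in> sets (hist_algebra M)" for \<gamma>
  proof -
    note [measurable] = measurable_gpolicy_real[OF g t]
    have "{\<xi> \<in> space (hist_algebra M). \<forall>a\<in>UNIV.
        real_of_int (g t (restrict \<xi> {1..t}) $ a) = real_of_int (\<gamma> $ a)} \<in> sets (hist_algebra M)"
      by measurable
    also have "{\<xi> \<in> space (hist_algebra M). \<forall>a\<in>UNIV.
        real_of_int (g t (restrict \<xi> {1..t}) $ a) = real_of_int (\<gamma> $ a)} =
        (\<lambda>\<xi>. g t (restrict \<xi> {1..t})) -` {\<gamma>} \<inter> space (hist_algebra M)"
      by (auto simp: vec_eq_iff)
    finally show ?thesis .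
  qed
  then show ?thesis by (simp add: measurable_count_space_eq_countable)
qed

lemma measurable_matrix_mult:
  fixes A :: "real^'n^'m"
  shows "f \<in> borel_measurable N \<Longrightarrow> (\<lambda>x. A *v f x) \<in> borel_measurable N"
  by (rule measurable_continuous_compose[OF linear_continuous_on[OF matrix_vector_mul_bounded_linear]])

lemma measurable_state:
  fixes M :: "('x::finite, 'u::finite, 'g::finite, 'k::finite, 'm::finite) drmic"
  assumes u: "u \<in> N_u M" and g: "g \<in> Pi_g M b" and "t \<le> horizon M"
  shows "(\<lambda>\<xi>. state M u g \<xi> t) \<in> borel_measurable (hist_algebra M)"
  using assms(3)
proof (induction t)
  case (Suc t)
  show ?case
  proof (cases "t = 0")
    case True
    then show ?thesis using Suc by (simp add: measurable_matrix_mult)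
  next
    case False
    then have t: "t \<in> {1..horizon M}" using Suc.prems by simp
    have mg: "(\<lambda>\<xi>. real_vec (g t (restrict \<xi> {1..t}))) \<in> borel_measurable (hist_algebra M)"
      by (rule borel_measurable_vecI)
        (simp only: real_vec_def vec_lambda_beta measurable_gpolicy_real[OF g t])
    have "(\<lambda>\<xi>. dynA M t *v state M u g \<xi> t + (dynB M t *v u t (restrict \<xi> {1..t}) +
        dynC M t *v real_vec (g t (restrict \<xi> {1..t})) + dynD M t *v \<xi> t))
        \<in> borel_measurable (hist_algebra M)"
      using Suc.prems by (intro borel_measurable_add measurable_matrix_mult Suc.IH mg
          measurable_upolicy[OF u t] measurable_hist_component[OF t]) simp
    then show ?thesis using False by simp
  qed
qed simp

lemma measurable_run_cost:
  fixes M :: "('x::finite, 'u::finite, 'g::finite, 'k::finite, 'm::finite) drmic"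
  assumes cost: "\<forall>t\<in>{1..horizon M}. \<forall>\<gamma>. continuous_on UNIV (\<lambda>(x, u). cost M t x u \<gamma>)"
    and u: "u \<in> N_u M" and g: "g \<in> Pi_g M b"
  shows "run_cost M u g \<in> borel_measurable (hist_algebra M)"
  unfolding run_cost_def[abs_def]
proof (intro borel_measurable_sum borel_measurable_times borel_measurable_const)
  fix t assume t: "t \<in> {1..horizon M}"
  show "(\<lambda>\<xi>. cost M t (state M u g \<xi> t) (u t (restrict \<xi> {1..t})) (g t (restrict \<xi> {1..t})))
      \<in> borel_measurable (hist_algebra M)"
  proof (rule measurable_compose_countable[OF _ measurable_gpolicy[OF g t]])
    fix \<gamma>
    have "continuous_on UNIV (\<lambda>z. cost M t (fst z) (snd z) \<gamma>)"
      using cost t by (simp add: case_prod_beta')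
    moreover have "(\<lambda>\<xi>. state M u g \<xi> t) \<in> borel_measurable (hist_algebra M)"
      using t by (intro measurable_state[OF u g]) simp
    ultimately show "(\<lambda>\<xi>. cost M t (state M u g \<xi> t) (u t (restrict \<xi> {1..t})) \<gamma>)
        \<in> borel_measurable (hist_algebra M)"
      using measurable_upolicy[OF u t]
      by (rule borel_measurable_continuous_Pair[where H = "\<lambda>x v. cost M t x v \<gamma>", rotated 2])
  qed
qed

lemma J_run_cost: "J M u g = (SUP P\<in>ambiguity M. ereal (\<integral>\<xi>. run_cost M u g \<xi> \<partial>P))"
  by (simp add: J_def run_cost_def)

text \<open>
  The running costs are bounded and measurable, so a pointwise comparison on the support passes to
  the expectation under every measure of the ambiguity set.
\<close>

lemma J_le_add:
  fixes M :: "('x::finite, 'u::finite, 'g::finite, 'k::finite, 'm::finite) drmic"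
  assumes ambiguity: "ambiguity M \<subseteq> prob_measures M"
    and cost: "\<forall>t\<in>{1..horizon M}. \<forall>\<gamma>. continuous_on UNIV (\<lambda>(x, u). cost M t x u \<gamma>)"
    and N: "u \<in> N_u M" "v \<in> N_u M" "g \<in> Pi_g M b"
    and close: "\<And>\<xi>. \<xi> \<in> Xi M \<Longrightarrow> run_cost M v g \<xi> \<le> run_cost M u g \<xi> + e"
  shows "J M v g \<le> J M u g + ereal e"
  unfolding J_run_cost
proof (rule SUP_least)
  fix P assume P: "P \<in> ambiguity M"
  then have sets: "sets P = sets (hist_algebra M)" and "prob_space P"
    using ambiguity by (auto simp: prob_measures_def)
  interpret prob_space P by fact
  have space: "space P = Xi M" using sets_eq_imp_space_eq[OF sets] space_hist_algebra by simp
  have int: "integrable P (run_cost M w g)" if w: "w \<in> N_u M" for w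
  proof -
    obtain B where B: "\<forall>x\<in>run_cost M w g ` Xi M. norm x \<le> B"
      using bounded_run_cost[OF cost w N(3)] unfolding bounded_iff by blast
    have "run_cost M w g \<in> borel_measurable P"
      using measurable_run_cost[OF cost w N(3)] measurable_cong_sets[OF sets refl] by blast
    then show ?thesis
      using B by (intro integrable_const_bound[where B = B] AE_I2) (auto simp: space)
  qed
  have "(\<integral>\<xi>. run_cost M v g \<xi> \<partial>P) \<le> (\<integral>\<xi>. run_cost M u g \<xi> + e \<partial>P)"
    by (intro integral_mono Bochner_Integration.integrable_add int N integrable_const)
      (auto simp: space close)
  also have "\<dots> = (\<integral>\<xi>. run_cost M u g \<xi> \<partial>P) + e"
    using int[OF N(1)] by (simp add: prob_space)
  finally have "ereal (\<integral>\<xi>. run_cost M v g \<xi> \<partial>P) \<le> ereal (\<integral>\<xi>. run_cost M u g \<xi> \<partial>P) + ereal e" by simp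
  also have "\<dots> \<le> (SUP P\<in>ambiguity M. ereal (\<integral>\<xi>. run_cost M u g \<xi> \<partial>P)) + ereal e"
    using P by (intro add_right_mono SUP_upper)
  finally show "ereal (\<integral>\<xi>. run_cost M v g \<xi> \<partial>P) \<le>
      (SUP P\<in>ambiguity M. ereal (\<integral>\<xi>. run_cost M u g \<xi> \<partial>P)) + ereal e" .
qed

section \<open>Convergence of the optimal values\<close>

text \<open>
  A sequence of feasible lifted approximations converges uniformly to \<open>u\<close>, so its running costs
  converge uniformly and one of its members is good enough. The breakpoints vary along the
  sequence, but each of them represents \<open>g\<close>.
\<close>

lemma lifted_value_close:
  fixes M :: "('x::finite, 'u::finite, 'g::finite, 'k::finite, 'm::finite) drmic"
  assumes horizon: "horizon M \<ge> 1"
    and support: "\<forall>t\<in>{1..horizon M}. \<forall>i. lower M t $ i < upper M t $ i"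
    and ambiguity: "ambiguity M \<subseteq> prob_measures M"
    and cost: "\<forall>t\<in>{1..horizon M}. \<forall>\<gamma>. continuous_on UNIV (\<lambda>(x, u). cost M t x u \<gamma>)"
    and interior: "Metric_space.mtopology (N_u M) (policy_dist M) interior_of feasible_u M g \<noteq> {}"
    and u: "u \<in> N_u M" and g: "g \<in> N_g M" and feas: "feasible M u g" and e: "0 < e"
  obtains b where "b \<in> breakpoint_choices M" "J_opt M (Pi_u M b) (Pi_g M b) \<le> J M u g + ereal e"
proof -
  have "\<exists>b v. b \<in> breakpoint_choices M \<and> g \<in> Pi_g M b \<and> v \<in> Pi_u M b \<and> feasible M v g \<and>
      (\<forall>t\<in>{1..horizon M}. \<forall>\<xi>\<in>Xi_upto M t. \<forall>a. \<bar>v t \<xi> $ a - u t \<xi> $ a\<bar> \<le> inverse (real (Suc n)))"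
    for n
    by (rule feasible_lifted_approximation[OF horizon support interior u g feas, of "inverse (real (Suc n))"])
      (simp, blast)
  then obtain bs us where bs: "\<And>n. bs n \<in> breakpoint_choices M" "\<And>n. g \<in> Pi_g M (bs n)"
    and us: "\<And>n. us n \<in> Pi_u M (bs n)" "\<And>n. feasible M (us n) g"
    and close: "\<And>n t \<xi> a. t \<in> {1..horizon M} \<Longrightarrow> \<xi> \<in> Xi_upto M t \<Longrightarrow>
      \<bar>us n t \<xi> $ a - u t \<xi> $ a\<bar> \<le> inverse (real (Suc n))"
    by metis
  have lim: "uniform_limit (Xi_upto M t) (\<lambda>n. us n t) (u t) sequentially"
    if t: "t \<in> {1..horizon M}" for t
  proof (rule uniform_limitI)
    fix d :: real assume d: "0 < d"
    have "(\<lambda>n. real CARD('u) * inverse (real (Suc n))) \<longlonglongrightarrow> real CARD('u) * 0"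
      by (intro tendsto_mult tendsto_const LIMSEQ_inverse_real_of_nat)
    then have "\<forall>\<^sub>F n in sequentially. real CARD('u) * inverse (real (Suc n)) < d"
      by (rule order_tendstoD) (use d in simp)
    then show "\<forall>\<^sub>F n in sequentially. \<forall>\<xi>\<in>Xi_upto M t. dist (us n t \<xi>) (u t \<xi>) < d"
    proof eventually_elim
      case (elim n)
      have "dist (us n t \<xi>) (u t \<xi>) \<le> (\<Sum>a\<in>(UNIV :: 'u set). inverse (real (Suc n)))"
        if "\<xi> \<in> Xi_upto M t" for \<xi>
        unfolding dist_norm using close[OF t that]
        by (intro order_trans[OF norm_le_l1_cart] sum_mono) simp
      then show ?case using elim by force
    qed
  qed
  have ev: "\<forall>\<^sub>F n in sequentially. \<forall>\<xi>\<in>Xi M. dist (run_cost M (us n) g \<xi>) (run_cost M u g \<xi>) < e"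
    by (rule uniform_limitD[OF uniform_limit_run_cost[OF cost lim u bs(2)] e])
  obtain n where n: "\<forall>\<xi>\<in>Xi M. dist (run_cost M (us n) g \<xi>) (run_cost M u g \<xi>) < e"
    using eventually_happens'[OF sequentially_bot ev] by blast
  have "J_opt M (Pi_u M (bs n)) (Pi_g M (bs n)) \<le> J M (us n) g"
    unfolding J_opt_def by (rule INF_lower2[of "(us n, g)"]) (simp_all add: bs us)
  also have "\<dots> \<le> J M u g + ereal e"
  proof (rule J_le_add[OF ambiguity cost u _ bs(2)])
    show "us n \<in> N_u M" using us(1) Pi_u_subset_N_u by blast
    show "run_cost M (us n) g \<xi> \<le> run_cost M u g \<xi> + e" if "\<xi> \<in> Xi M" for \<xi>
      using n[rule_format, OF that] by (simp add: dist_real_def)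
  qed
  finally show ?thesis using that bs(1) by blast
qed

theorem theorem1:
  fixes M :: "('x::finite, 'u::finite, 'g::finite, 'k::finite, 'm::finite) drmic"
  assumes horizon: "horizon M \<ge> 1"
    and support: "\<forall>t\<in>{1..horizon M}. \<forall>i. lower M t $ i < upper M t $ i"
    and ambiguity: "ambiguity M \<noteq> {}" "ambiguity M \<subseteq> prob_measures M"
    and discount: "\<forall>t\<in>{1..horizon M}. discount M t \<in> {0..1}"
    and cost: "\<forall>t\<in>{1..horizon M}. \<forall>\<gamma>. continuous_on UNIV (\<lambda>(x, u). cost M t x u \<gamma>)"
    and interior: "\<forall>g\<in>N_g M. (\<exists>u\<in>N_u M. feasible M u g) \<longrightarrow>
      Metric_space.mtopology (N_u M) (policy_dist M) interior_of feasible_u M g \<noteq> {}"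
  shows "((\<lambda>\<delta>. INF b\<in>{b \<in> breakpoint_choices M. largest_segment M b \<ge> \<delta>}.
             J_opt M (Pi_u M b) (Pi_g M b))
          \<longlongrightarrow> J_opt M (N_u M) (N_g M)) (at_right 0)"
    (is "(?F \<longlongrightarrow> ?L) _")
proof (rule order_tendstoI)
  have lower: "?L \<le> ?F \<delta>" for \<delta>
  proof (rule INF_greatest)
    fix b assume "b \<in> {b \<in> breakpoint_choices M. largest_segment M b \<ge> \<delta>}"
    then have "Pi_u M b \<subseteq> N_u M" "Pi_g M b \<subseteq> N_g M"
      using Pi_u_subset_N_u Pi_g_subset_N_g by blast+
    then show "?L \<le> J_opt M (Pi_u M b) (Pi_g M b)"
      unfolding J_opt_def by (intro INF_superset_mono) auto
  qed
  fix c
  show "\<forall>\<^sub>F \<delta> in at_right 0. c < ?F \<delta>" if "c < ?L"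
    using that lower by (intro always_eventually allI) (rule less_le_trans)
  show "\<forall>\<^sub>F \<delta> in at_right 0. ?F \<delta> < c" if upper: "?L < c"
  proof -
    obtain u g where N: "u \<in> N_u M" "g \<in> N_g M" and feas: "feasible M u g" and Jc: "J M u g < c"
      using upper unfolding J_opt_def INF_less_iff by auto
    \<comment> \<open>the expectation under any single \<open>P\<close> keeps the cost above \<open>-\<infinity>\<close>, so the gap to \<open>c\<close>
      contains a positive real error \<open>q - r\<close>\<close>
    obtain P where "P \<in> ambiguity M" using ambiguity by blast
    then have "J M u g \<noteq> -\<infinity>"
      unfolding J_run_cost using SUP_upper[of P "ambiguity M"] by (metis MInfty_neq_ereal(1) ereal_infty_less_eq(2))
    then obtain r where r: "J M u g = ereal r" using Jc by (cases "J M u g") auto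
    obtain q where q: "ereal r < ereal q" "ereal q < c"
      using Jc ereal_dense2[of "ereal r" c] unfolding r by blast
    have "Metric_space.mtopology (N_u M) (policy_dist M) interior_of feasible_u M g \<noteq> {}" "0 < q - r"
      using interior N feas q by auto
    then obtain b where b: "b \<in> breakpoint_choices M"
      and le: "J_opt M (Pi_u M b) (Pi_g M b) \<le> J M u g + ereal (q - r)"
      by (rule lifted_value_close[OF horizon support ambiguity(2) cost _ N feas])
    have "J_opt M (Pi_u M b) (Pi_g M b) < c" using le q by (simp add: r)
    moreover have "?F \<delta> \<le> J_opt M (Pi_u M b) (Pi_g M b)" if "\<delta> \<le> largest_segment M b" for \<delta>
      using b that by (intro INF_lower) simp
    ultimately have "?F \<delta> < c" if "\<delta> < largest_segment M b" for \<delta>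
      using that by (meson le_less_trans less_imp_le)
    then show ?thesis
      using largest_segment_pos[OF horizon support b]
      unfolding eventually_at_right_field by blast
  qed
qed

end
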